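(* Let $1\le p\le2$ and $\beta,\mu\in\mathbb{R}$ with $0<\beta-\frac1p<\mu$. For real parameters $b,m$ write $\mathcal{S}_{b,m}f(t)=\int_0^\infty\frac{u^{b-1}}{(1+u)^m}f(tu)\,du$, $t\in\mathbb{R}$. Then $$\widehat{\mathcal{S}_{\beta,\mu}(f)}=\mathcal{S}_{\mu-\beta+1,\mu}(\widehat f),\qquad f\in L^p(\mathbb{R});$$ in particular $\widehat{\mathcal{S}_{\beta,\mu}(f)}(x)=\mathcal{S}_{\mu-\beta+1,\mu}(\widehat f)(x)$ for almost every $x\in\mathbb{R}$. Likewise, for $n\in\mathbb{N}$, $\widehat{\mathcal{S}_{\beta,\mu}(f)}=\mathcal{S}_{\mu-\beta+1,\mu}(\widehat f)$ for every $f\in\mathcal{T}_p^{(n)}(|t|^n)$.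
   Context: The Fourier transform is $\widehat f(t)=\int_{-\infty}^\infty e^{-ixt}f(x)\,dx$ for $f\in L^1(\mathbb{R})$; for $f\in L^p(\mathbb{R})$, $1<p\le2$, $\widehat f\in L^{p'}(\mathbb{R})$ ($\frac1p+\frac1{p'}=1$) is the $L^{p'}$-limit as $R\to\infty$ of the Fourier transforms of $f\chi_{(-R,R)}$. For $n\in\mathbb{N}$, $\mathcal{T}_p^{(n)}(|t|^n)$ is the completion of the Schwartz class on $\mathbb{R}$ in the norm $\frac1{n!}\left(\int_{-\infty}^\infty|f^{(n)}(t)|^p|t|^{np}dt\right)^{1/p}$; it embeds continuously in $L^p(\mathbb{R})$ and is regarded as a subspace of it. *)

theory Defs
  imports "HOL-Analysis.Analysis"
begin

(* Elements of L^p are represented by functions, not by classes modulo null sets;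
   equality of classes is equality almost everywhere. *)

definition Lp_space :: "real \<Rightarrow> (real \<Rightarrow> complex) set" where
  "Lp_space p = {f \<in> borel_measurable lebesgue. integrable lebesgue (\<lambda>x. norm (f x) powr p)}"

definition Lp_norm :: "real \<Rightarrow> (real \<Rightarrow> complex) \<Rightarrow> real" where
  "Lp_norm p f = (LINT x|lebesgue. norm (f x) powr p) powr (1 / p)"

(* The membership conditions matter: the Bochner integral in Lp_norm is 0 for
   non-integrable arguments. *)
definition Lp_tendsto ::
  "real \<Rightarrow> ('i \<Rightarrow> real \<Rightarrow> complex) \<Rightarrow> (real \<Rightarrow> complex) \<Rightarrow> 'i filter \<Rightarrow> bool" where
  "Lp_tendsto p F g \<F> \<longleftrightarrow>
     g \<in> Lp_space p \<and> (\<forall>\<^sub>F i in \<F>. F i \<in> Lp_space p) \<and>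
     ((\<lambda>i. Lp_norm p (\<lambda>x. F i x - g x)) \<longlongrightarrow> 0) \<F>"

definition fourier_L1 :: "(real \<Rightarrow> complex) \<Rightarrow> real \<Rightarrow> complex" where
  "fourier_L1 f t = (LINT x|lebesgue. exp (- \<i> * of_real (x * t)) * f x)"

(* Intended for 1 \<le> p \<le> 2. For p > 1 the conjugate exponent is p / (p - 1), and the limit is
   determined only up to null sets, so one representative is chosen. *)
definition fourier :: "real \<Rightarrow> (real \<Rightarrow> complex) \<Rightarrow> real \<Rightarrow> complex" where
  "fourier p f =
     (if p = 1 then fourier_L1 f
      else (SOME g. Lp_tendsto (p / (p - 1))
              (\<lambda>R. fourier_L1 (\<lambda>x. indicator {-R<..<R} x *\<^sub>R f x)) g at_top))"

definition stieltjes_kernel :: "real \<Rightarrow> real \<Rightarrow> real \<Rightarrow> real" where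
  "stieltjes_kernel b m u = u powr (b - 1) / (1 + u) powr m"

definition stieltjes :: "real \<Rightarrow> real \<Rightarrow> (real \<Rightarrow> complex) \<Rightarrow> real \<Rightarrow> complex" where
  "stieltjes b m f t = (LINT u:{0<..}|lebesgue. stieltjes_kernel b m u *\<^sub>R f (t * u))"

(* Convergence of the integral defining stieltjes b m f t. *)
definition stieltjes_converges :: "real \<Rightarrow> real \<Rightarrow> (real \<Rightarrow> complex) \<Rightarrow> real \<Rightarrow> bool" where
  "stieltjes_converges b m f t \<longleftrightarrow>
     set_integrable lebesgue {0<..} (\<lambda>u. stieltjes_kernel b m u *\<^sub>R f (t * u))"

definition nth_deriv :: "nat \<Rightarrow> (real \<Rightarrow> complex) \<Rightarrow> real \<Rightarrow> complex" where
  "nth_deriv n = (\<lambda>f t. vector_derivative f (at t)) ^^ n"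

definition schwartz :: "(real \<Rightarrow> complex) set" where
  "schwartz = {f. (\<forall>j t. nth_deriv j f differentiable at t) \<and>
                  (\<forall>j k. bounded (range (\<lambda>t. t ^ k *\<^sub>R nth_deriv j f t)))}"

definition T_norm :: "nat \<Rightarrow> real \<Rightarrow> (real \<Rightarrow> complex) \<Rightarrow> real" where
  "T_norm n p f = 1 / fact n * Lp_norm p (\<lambda>t. \<bar>t\<bar> ^ n *\<^sub>R nth_deriv n f t)"

(* The completion of the Schwartz class in T_norm n p, regarded as a subspace of L^p: since the
   norm dominates the L^p norm up to a constant, a Cauchy sequence for it converges in L^p, and
   the element of the completion that it represents is identified with this limit. *)
definition T_space :: "nat \<Rightarrow> real \<Rightarrow> (real \<Rightarrow> complex) set" where
  "T_space n p = {f. \<exists>\<phi> :: nat \<Rightarrow> real \<Rightarrow> complex.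
     (\<forall>k. \<phi> k \<in> schwartz) \<and>
     (\<forall>e>0. \<exists>N. \<forall>i\<ge>N. \<forall>j\<ge>N. T_norm n p (\<lambda>t. \<phi> i t - \<phi> j t) < e) \<and>
     Lp_tendsto p \<phi> f sequentially}"

end

theory Submission
  imports Defs "HOL-Probability.Characteristic_Functions"
begin

text \<open>
  Substituting \<open>s = t u\<close> and then \<open>v = 1 / u\<close> turns the Fourier integral of
  \<open>S\<^sub>\<beta>\<^sub>,\<^sub>\<mu> f\<close> into \<open>S\<^sub>\<mu>\<^sub>-\<^sub>\<beta>\<^sub>+\<^sub>1\<^sub>,\<^sub>\<mu>\<close> applied to the Fourier transform of \<open>f\<close>,
  since \<open>k(1/v) / v\<close> is the kernel with parameters \<open>\<mu> - \<beta> + 1, \<mu>\<close> whenever \<open>k\<close> is the one with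
  parameters \<open>\<beta>, \<mu>\<close>.  Fubini justifies this if \<open>f\<close> and \<open>k(u) / u\<close> are integrable, which settles
  \<open>p = 1\<close>.  For \<open>p > 1\<close> the identity is applied to \<open>f\<close> cut off to \<open>(-n, n)\<close> and \<open>k\<close> cut off to
  \<open>(1/(n+1), n+1)\<close>, and \<open>n\<close> tends to infinity on both sides: the operators are bounded on \<open>L\<^sup>p\<close> and on
  \<open>L\<^sup>q\<close> because \<open>k(u) u\<^sup>-\<^sup>1\<^sup>/\<^sup>p\<close> is integrable, and the Fourier transform is continuous from \<open>L\<^sup>p\<close> to
  \<open>L\<^sup>q\<close>, \<open>q = p / (p - 1)\<close>.  The latter (the Hausdorff-Young inequality up to a constant) is obtained
  by interpolating between the trivial \<open>L\<^sup>1\<close> bound and the Plancherel inequality.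
  Elements of \<open>T_space n p\<close> are in particular elements of \<open>L\<^sup>p\<close>.
\<close>

subsection \<open>Powers of \<open>L\<^sup>p\<close> norms\<close>

text \<open>The Fubini argument needs \<open>f\<close> integrable and \<open>k(u) / u\<close>
  integrable on the half line. For p > 1 neither follows from the hypotheses, which only control
  \<open>k(u) u powr (-1/p)\<close>; hence both the function and the kernel are cut off. The
  substitution \<open>v = 1 / u\<close> carries the p-moment of one kernel into the q-moment of the
  other, so a single pair of inequalities bounds the operators on both sides. Only limits have to be
  controlled, so constants need not be sharp. This permits working with the p-th power of the norm
  as an extended nonnegative number: no root is extracted, divergence shows up as infinity instead
  of the default value 0, and a triangle inequality with constant \<open>2 powr p\<close> replaces
  Minkowski's. Representatives need care: elements of L^p are Lebesgue measurable, while product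
  measures and Fubini are applied to Borel functions, so each argument first passes to a Borel
  representative.\<close>

definition power_integral :: "real \<Rightarrow> (real \<Rightarrow> complex) \<Rightarrow> ennreal" where
  "power_integral p f = (\<integral>\<^sup>+x. ennreal (norm (f x) powr p) \<partial>lborel)"

lemma power_integral_lebesgue:
  "power_integral p f = (\<integral>\<^sup>+x. ennreal (norm (f x) powr p) \<partial>lebesgue)"
  by (simp add: power_integral_def nn_integral_completion)

lemma power_integral_cong_AE:
  "(AE x in lborel. f x = g x) \<Longrightarrow> power_integral p f = power_integral p g"
  unfolding power_integral_def by (rule nn_integral_cong_AE) auto

lemma power_integral_mono_AE:
  assumes "AE x in lborel. norm (f x) \<le> norm (g x)" and "0 \<le> p"
  shows "power_integral p f \<le> power_integral p g"
  unfolding power_integral_def using assms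
  by (intro nn_integral_mono_AE) (auto elim!: eventually_mono intro!: ennreal_leI powr_mono2)

lemma powr_add_le:
  fixes a b p :: real
  assumes "0 \<le> a" "0 \<le> b" "0 \<le> p"
  shows "(a + b) powr p \<le> 2 powr p * (a powr p + b powr p)"
proof -
  have "(a + b) powr p \<le> (2 * max a b) powr p"
    using assms by (intro powr_mono2) auto
  also have "\<dots> = 2 powr p * max a b powr p"
    using assms by (simp add: powr_mult)
  also have "\<dots> \<le> 2 powr p * (a powr p + b powr p)"
    by (intro mult_left_mono) (auto simp: max_def)
  finally show ?thesis .
qed

lemma power_integral_add:
  assumes [measurable]: "f \<in> borel_measurable lebesgue" "g \<in> borel_measurable lebesgue"
    and p: "0 \<le> p"
  shows "power_integral p (\<lambda>x. f x + g x)
    \<le> ennreal (2 powr p) * (power_integral p f + power_integral p g)"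
proof -
  have "power_integral p (\<lambda>x. f x + g x)
      \<le> (\<integral>\<^sup>+x. ennreal (2 powr p) * (ennreal (norm (f x) powr p) + ennreal (norm (g x) powr p)) \<partial>lebesgue)"
    unfolding power_integral_lebesgue
  proof (intro nn_integral_mono)
    fix x
    have "norm (f x + g x) powr p \<le> (norm (f x) + norm (g x)) powr p"
      using p by (intro powr_mono2 norm_triangle_ineq) auto
    also have "\<dots> \<le> 2 powr p * (norm (f x) powr p + norm (g x) powr p)"
      using p by (intro powr_add_le) auto
    finally show "ennreal (norm (f x + g x) powr p)
        \<le> ennreal (2 powr p) * (ennreal (norm (f x) powr p) + ennreal (norm (g x) powr p))"
      by (simp add: ennreal_leI flip: ennreal_plus ennreal_mult)
  qed
  also have "\<dots> = ennreal (2 powr p) * (power_integral p f + power_integral p g)"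
    unfolding power_integral_lebesgue by (simp add: nn_integral_cmult nn_integral_add)
  finally show ?thesis .
qed

lemma power_integral_uminus: "power_integral p (\<lambda>x. - f x) = power_integral p f"
  by (simp add: power_integral_def)

lemma power_integral_diff:
  assumes "f \<in> borel_measurable lebesgue" "g \<in> borel_measurable lebesgue" "0 \<le> p"
  shows "power_integral p (\<lambda>x. f x - g x)
    \<le> ennreal (2 powr p) * (power_integral p f + power_integral p g)"
  using power_integral_add[of f "\<lambda>x. - g x" p] assms by (simp add: power_integral_uminus)

lemma power_integral_diff_commute:
  "power_integral p (\<lambda>x. f x - g x) = power_integral p (\<lambda>x. g x - f x)"
  by (simp add: power_integral_def norm_minus_commute)

lemma power_integral_diff_finite:
  assumes "f \<in> borel_measurable lebesgue" "g \<in> borel_measurable lebesgue" "0 \<le> p"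
    and "power_integral p f < \<infinity>" "power_integral p g < \<infinity>"
  shows "power_integral p (\<lambda>x. f x - g x) < \<infinity>"
  using power_integral_diff[OF assms(1-3)] assms(4,5)
  by (simp add: ennreal_mult_less_top order_le_less_trans)

lemma power_integral_triangle_tendsto:
  assumes "\<And>i. F i \<in> borel_measurable lebesgue" "\<And>i. G i \<in> borel_measurable lebesgue"
    "\<And>i. H i \<in> borel_measurable lebesgue" and p: "0 \<le> p"
    and FG: "((\<lambda>i. power_integral p (\<lambda>x. F i x - G i x)) \<longlongrightarrow> 0) L"
    and GH: "((\<lambda>i. power_integral p (\<lambda>x. G i x - H i x)) \<longlongrightarrow> 0) L"
  shows "((\<lambda>i. power_integral p (\<lambda>x. F i x - H i x)) \<longlongrightarrow> 0) L"
proof (rule tendsto_sandwich[OF _ _ tendsto_const])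
  show "((\<lambda>i. ennreal (2 powr p) * (power_integral p (\<lambda>x. F i x - G i x)
      + power_integral p (\<lambda>x. G i x - H i x))) \<longlongrightarrow> 0) L"
    using ennreal_tendsto_cmult[OF _ tendsto_add[OF FG GH], of "ennreal (2 powr p)"] by simp
  show "\<forall>\<^sub>F i in L. power_integral p (\<lambda>x. F i x - H i x)
      \<le> ennreal (2 powr p) * (power_integral p (\<lambda>x. F i x - G i x)
      + power_integral p (\<lambda>x. G i x - H i x))"
  proof (intro always_eventually allI)
    fix i
    show "power_integral p (\<lambda>x. F i x - H i x)
      \<le> ennreal (2 powr p) * (power_integral p (\<lambda>x. F i x - G i x)
      + power_integral p (\<lambda>x. G i x - H i x))"
      using power_integral_add[of "\<lambda>x. F i x - G i x" "\<lambda>x. G i x - H i x" p] assms(1-4)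
      by simp
  qed
qed auto

lemma power_integral_eq_0:
  assumes "f \<in> borel_measurable lebesgue" "power_integral p f = 0"
  shows "AE x in lebesgue. f x = 0"
  using assms nn_integral_0_iff_AE[of "\<lambda>x. ennreal (norm (f x) powr p)" lebesgue]
  by (auto simp: power_integral_lebesgue)

section \<open>Translation of L^p membership and convergence into power integrals\<close>

lemma Lp_space_iff:
  "f \<in> Lp_space p \<longleftrightarrow> f \<in> borel_measurable lebesgue \<and> power_integral p f < \<infinity>"
  by (auto simp: Lp_space_def power_integral_lebesgue integrable_iff_bounded)

lemma Lp_norm_eq:
  assumes "f \<in> borel_measurable lebesgue"
  shows "Lp_norm p f = enn2real (power_integral p f) powr (1 / p)"
  unfolding Lp_norm_def power_integral_lebesgue using assms
  by (subst integral_eq_nn_integral) auto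

text \<open>The membership conditions make the power integral of the difference eventually finite.
  This lets the limit pass through \<open>enn2real\<close>, which sends infinity to 0 and would
  otherwise hide divergence; the powers \<open>p\<close> and \<open>1 / p\<close> preserve
  convergence to 0 because the exponents are positive.\<close>

lemma Lp_tendsto_iff:
  assumes p: "0 < p"
  shows "Lp_tendsto p F g L \<longleftrightarrow> g \<in> Lp_space p \<and> (\<forall>\<^sub>F i in L. F i \<in> Lp_space p) \<and>
    ((\<lambda>i. power_integral p (\<lambda>x. F i x - g x)) \<longlongrightarrow> 0) L"
proof -
  have "((\<lambda>i. Lp_norm p (\<lambda>x. F i x - g x)) \<longlongrightarrow> 0) L \<longleftrightarrow>
      ((\<lambda>i. power_integral p (\<lambda>x. F i x - g x)) \<longlongrightarrow> 0) L"
    if g: "g \<in> Lp_space p" and F: "\<forall>\<^sub>F i in L. F i \<in> Lp_space p"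
  proof -
    let ?a = "\<lambda>i. power_integral p (\<lambda>x. F i x - g x)"
    have ev: "\<forall>\<^sub>F i in L. ?a i < \<infinity> \<and> Lp_norm p (\<lambda>x. F i x - g x) = enn2real (?a i) powr (1 / p)"
      using F
    proof eventually_elim
      case (elim i)
      then show ?case
        using g p power_integral_diff_finite[of "F i" g p]
        by (auto simp: Lp_space_iff intro!: Lp_norm_eq)
    qed
    have "((\<lambda>i. Lp_norm p (\<lambda>x. F i x - g x)) \<longlongrightarrow> 0) L \<longleftrightarrow>
        ((\<lambda>i. enn2real (?a i) powr (1 / p)) \<longlongrightarrow> 0) L"
    proof (intro tendsto_cong)
      show "\<forall>\<^sub>F i in L. Lp_norm p (\<lambda>x. F i x - g x) = enn2real (?a i) powr (1 / p)"
        using ev by eventually_elim simp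
    qed
    also have "\<dots> \<longleftrightarrow> ((\<lambda>i. enn2real (?a i)) \<longlongrightarrow> 0) L"
    proof
      assume "((\<lambda>i. enn2real (?a i) powr (1 / p)) \<longlongrightarrow> 0) L"
      from tendsto_powr'[OF this tendsto_const[of p]] p
      show "((\<lambda>i. enn2real (?a i)) \<longlongrightarrow> 0) L"
        by (simp add: powr_powr)
    next
      assume "((\<lambda>i. enn2real (?a i)) \<longlongrightarrow> 0) L"
      from tendsto_powr'[OF this tendsto_const[of "1 / p"]] p
      show "((\<lambda>i. enn2real (?a i) powr (1 / p)) \<longlongrightarrow> 0) L"
        by simp
    qed
    also have "\<dots> \<longleftrightarrow> ((\<lambda>i. ennreal (enn2real (?a i))) \<longlongrightarrow> 0) L"
      using tendsto_ennreal_iff[where F = L and f = "\<lambda>i. enn2real (?a i)" and x = 0] by simp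
    also have "\<dots> \<longleftrightarrow> (?a \<longlongrightarrow> 0) L"
    proof (intro tendsto_cong)
      show "\<forall>\<^sub>F i in L. ennreal (enn2real (?a i)) = ?a i"
        using ev by eventually_elim simp
    qed
    finally show ?thesis .
  qed
  then show ?thesis
    unfolding Lp_tendsto_def by auto
qed

text \<open>Treating real and imaginary part separately yields the Borel representatives on which
  the product-measure arguments rely.\<close>

lemma completion_ex_borel_measurable_complex:
  fixes f :: "'a \<Rightarrow> complex"
  assumes f: "f \<in> borel_measurable (completion M)"
  obtains g where "g \<in> borel_measurable M" "AE x in M. f x = g x"
proof -
  have "(\<lambda>x. Re (f x)) \<in> borel_measurable (completion M)"
    "(\<lambda>x. Im (f x)) \<in> borel_measurable (completion M)"
    by (rule measurable_compose[OF f], simp)+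
  then obtain a b where [measurable]: "a \<in> borel_measurable M" "b \<in> borel_measurable M"
    and ab: "AE x in M. Re (f x) = a x" "AE x in M. Im (f x) = b x"
    by (blast dest: completion_ex_borel_measurable_real)
  show thesis
  proof
    have *: "(\<lambda>x. Complex (a x) (b x)) = (\<lambda>x. complex_of_real (a x) + \<i> * complex_of_real (b x))"
      by (intro ext Complex_eq)
    show "(\<lambda>x. Complex (a x) (b x)) \<in> borel_measurable M"
      unfolding * by measurable
    show "AE x in M. f x = Complex (a x) (b x)"
      using ab by eventually_elim (simp add: complex_eq_iff)
  qed
qed

text \<open>Riesz-Fischer for a family indexed by a real parameter: a fast subsequence converges
  almost everywhere, and Fatou's lemma turns this into convergence of the whole family. Only
  weighted p-th powers are summed, so Minkowski's inequality is avoided and every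
  \<open>p > 0\<close> is allowed.\<close>

lemma power_integral_complete:
  fixes F :: "real \<Rightarrow> real \<Rightarrow> complex"
  assumes F[measurable]: "\<And>R. F R \<in> borel_measurable borel" and p: "0 < p"
    and fin: "\<And>R. power_integral p (F R) < \<infinity>"
    and Cauchy: "\<And>e. 0 < e \<Longrightarrow> \<exists>N. \<forall>R\<ge>N. \<forall>R'\<ge>N. power_integral p (\<lambda>x. F R x - F R' x) \<le> ennreal e"
  shows "\<exists>g. Lp_tendsto p F g at_top"
proof -
  let ?D = "\<lambda>R R'. power_integral p (\<lambda>x. F R x - F R' x)"
  \<comment> \<open>Against the weight \<open>2 powr (p * n)\<close> introduced below, this rate
    leaves the summable \<open>(1/2) ^ n\<close>, while finiteness of the weighted sum at
    \<open>x\<close> forces \<open>norm (?G (Suc n) x - ?G n x) \<le> (1/2) ^ n\<close> for large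
    \<open>n\<close>.\<close>
  define e where "e = (\<lambda>n::nat. (1/2) powr ((p + 1) * real n))"
  have e_pos: "0 < e n" for n by (simp add: e_def)
  obtain N0 where N0: "\<And>n R R'. N0 n \<le> R \<Longrightarrow> N0 n \<le> R' \<Longrightarrow> ?D R R' \<le> ennreal (e n)"
    using Cauchy[OF e_pos] by metis
  \<comment> \<open>The maximum makes the thresholds increasing, so that \<open>N (Suc n)\<close>
    also lies beyond \<open>N n\<close>.\<close>
  define N where "N = (\<lambda>n. Max (N0 ` {..n}))"
  have N_mono: "N m \<le> N n" if "m \<le> n" for m n
    unfolding N_def using that by (intro Max_mono) auto
  have N: "?D R R' \<le> ennreal (e n)" if "N n \<le> R" "N n \<le> R'" for n R R'
    using that by (intro N0) (auto simp: N_def)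
  let ?G = "\<lambda>n. F (N n)"
  have "(\<integral>\<^sup>+x. (\<Sum>n. ennreal (2 powr (p * n) * norm (?G (Suc n) x - ?G n x) powr p)) \<partial>lborel)
      = (\<Sum>n. \<integral>\<^sup>+x. ennreal (2 powr (p * n) * norm (?G (Suc n) x - ?G n x) powr p) \<partial>lborel)"
    by (intro nn_integral_suminf) measurable
  also have "\<dots> = (\<Sum>n. ennreal (2 powr (p * n)) * ?D (N (Suc n)) (N n))"
    unfolding power_integral_def by (simp add: ennreal_mult nn_integral_cmult)
  also have "\<dots> \<le> (\<Sum>n. ennreal ((1/2) ^ n))"
  proof (intro suminf_le)
    fix n
    have "ennreal (2 powr (p * n)) * ?D (N (Suc n)) (N n) \<le> ennreal (2 powr (p * n)) * ennreal (e n)"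
      by (intro mult_left_mono N N_mono) auto
    also have "\<dots> = ennreal ((1/2) ^ n)"
      by (simp add: e_def powr_add powr_minus powr_divide powr_realpow field_simps flip: ennreal_mult)
    finally show "ennreal (2 powr (p * n)) * ?D (N (Suc n)) (N n) \<le> ennreal ((1/2) ^ n)" .
  qed auto
  also have "\<dots> < \<infinity>"
    by (simp add: ennreal_suminf_neq_top less_top summable_geometric)
  finally have "AE x in lborel. (\<Sum>n. ennreal (2 powr (p * n) * norm (?G (Suc n) x - ?G n x) powr p)) \<noteq> \<infinity>"
    by (intro nn_integral_PInf_AE) auto
  then have conv: "AE x in lborel. convergent (\<lambda>n. ?G n x)"
  proof eventually_elim
    case (elim x)
    let ?t = "\<lambda>n. 2 powr (p * n) * norm (?G (Suc n) x - ?G n x) powr p"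
    have "summable ?t"
      using elim by (intro summable_suminf_not_top) (auto simp: infinity_ennreal_def)
    then have "?t \<longlonglongrightarrow> 0" by (rule summable_LIMSEQ_zero)
    then have "\<forall>\<^sub>F n in sequentially. ?t n < 1"
      by (rule order_tendstoD) simp
    then have "\<forall>\<^sub>F n in sequentially. norm (?G (Suc n) x - ?G n x) \<le> (1/2) ^ n"
    proof eventually_elim
      case (elim n)
      have "?t n = (2 powr n * norm (?G (Suc n) x - ?G n x)) powr p"
        by (simp add: powr_mult powr_powr mult.commute)
      then have "2 powr n * norm (?G (Suc n) x - ?G n x) < 1"
        using elim p powr_mono2[of p 1 "2 powr n * norm (?G (Suc n) x - ?G n x)"]
        by (intro not_le_imp_less notI) auto
      then show ?case
        by (simp add: powr_realpow power_divide field_simps)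
    qed
    then have "summable (\<lambda>n. ?G (Suc n) x - ?G n x)"
      by (rule summable_comparison_test_ev) simp
    then have "convergent (\<lambda>n. \<Sum>i<n. ?G (Suc i) x - ?G i x)"
      by (simp add: summable_iff_convergent)
    then have "convergent (\<lambda>n. ?G n x - ?G 0 x)"
      by (simp only: sum_lessThan_telescope[of "\<lambda>n. ?G n x"])
    from convergent_add[OF this convergent_const[of "?G 0 x"]] show ?case
      by simp
  qed
  define g where "g = (\<lambda>x. lim (\<lambda>n. ?G n x))"
  have g[measurable]: "g \<in> borel_measurable borel"
    unfolding g_def by measurable
  \<comment> \<open>\<open>R\<close> is any real beyond \<open>N n\<close>, not just a member of the
    subsequence; this is what gives the limit along \<open>at_top\<close>.\<close>
  have Fatou: "power_integral p (\<lambda>x. F R x - g x) \<le> ennreal (e n)" if R: "N n \<le> R" for R n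
  proof -
    have "power_integral p (\<lambda>x. F R x - g x)
        \<le> (\<integral>\<^sup>+x. liminf (\<lambda>k. ennreal (norm (F R x - ?G k x) powr p)) \<partial>lborel)"
      unfolding power_integral_def using conv
    proof (intro nn_integral_mono_AE, eventually_elim)
      case (elim x)
      then have "(\<lambda>k. ?G k x) \<longlonglongrightarrow> g x"
        unfolding g_def by (simp only: convergent_LIMSEQ_iff)
      then have "(\<lambda>k. ennreal (norm (F R x - ?G k x) powr p)) \<longlonglongrightarrow> ennreal (norm (F R x - g x) powr p)"
        using p by (intro tendsto_ennrealI tendsto_powr' tendsto_intros) auto
      from lim_imp_Liminf[OF _ this] show ?case by simp
    qed
    also have "\<dots> \<le> liminf (\<lambda>k. ?D R (N k))"
      unfolding power_integral_def by (rule nn_integral_liminf) measurable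
    also have "\<dots> \<le> limsup (\<lambda>k. ?D R (N k))"
      by (intro Liminf_le_Limsup) simp
    also have "\<dots> \<le> ennreal (e n)"
      using N_mono R N by (intro Limsup_bounded eventually_sequentiallyI[of n]) auto
    finally show ?thesis .
  qed
  have e_lim: "(\<lambda>n. ennreal (e n)) \<longlonglongrightarrow> 0"
  proof -
    have "e = (\<lambda>n. ((1/2) powr (p + 1)) ^ n)"
      by (simp add: e_def fun_eq_iff powr_powr[symmetric] powr_realpow)
    moreover have "(1/2::real) powr (p + 1) < 1"
      using p powr_less_mono2[of "p + 1" "1/2" 1] by simp
    ultimately have "e \<longlonglongrightarrow> 0"
      by (simp add: LIMSEQ_realpow_zero)
    then show ?thesis
      using tendsto_ennrealI[of e 0] by simp
  qed
  have "((\<lambda>R. power_integral p (\<lambda>x. F R x - g x)) \<longlongrightarrow> 0) at_top"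
  proof (rule order_tendstoI)
    fix a :: ennreal assume "0 < a"
    with e_lim have "\<forall>\<^sub>F n in sequentially. ennreal (e n) < a"
      by (rule order_tendstoD)
    then obtain n where "ennreal (e n) < a"
      by (auto simp: eventually_sequentially)
    then show "\<forall>\<^sub>F R in at_top. power_integral p (\<lambda>x. F R x - g x) < a"
      using Fatou order_le_less_trans by (intro eventually_at_top_linorderI[of "N n"]) blast
  qed simp
  moreover have "power_integral p g < \<infinity>"
  proof -
    have "power_integral p (\<lambda>x. F (N 0) x - g x) < \<infinity>"
      using Fatou[of 0 "N 0"] order_le_less_trans by fastforce
    with power_integral_diff_finite[of "F (N 0)" "\<lambda>x. F (N 0) x - g x" p] fin p
    show ?thesis by (simp add: borel_measurable_diff measurable_completion)
  qed
  ultimately show ?thesis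
    using p fin by (intro exI[of _ g]) (auto simp: Lp_tendsto_iff Lp_space_iff measurable_completion)
qed

subsection \<open>Plancherel inequality\<close>

lemma norm_exp_minus_i_of_real [simp]: "norm (exp (- (\<i> * complex_of_real a))) = 1"
  by (simp add: norm_exp_eq_Re)

lemma ennreal_norm_integral_le:
  fixes f :: "'a \<Rightarrow> 'b::{banach, second_countable_topology}"
  shows "ennreal (norm (integral\<^sup>L M f)) \<le> (\<integral>\<^sup>+x. norm (f x) \<partial>M)"
  by (cases "integrable M f") (simp_all add: integral_norm_bound_ennreal not_integrable_integral_eq)

lemma fourier_L1_borel:
  assumes [measurable]: "f \<in> borel_measurable borel"
  shows "fourier_L1 f t = (LINT x|lborel. exp (- \<i> * of_real (x * t)) * f x)"
  unfolding fourier_L1_def by (rule integral_completion) measurable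

lemma fourier_L1_cong_AE:
  assumes "AE x in lebesgue. f x = g x"
    and "f \<in> borel_measurable lebesgue" "g \<in> borel_measurable lebesgue"
  shows "fourier_L1 f = fourier_L1 g"
proof
  fix t
  have [measurable]: "f \<in> borel_measurable lebesgue" "g \<in> borel_measurable lebesgue"
    by fact+
  have [measurable]: "(\<lambda>x. exp (- \<i> * of_real (x * t))) \<in> borel_measurable lebesgue"
    by (rule measurable_completion) measurable
  show "fourier_L1 f t = fourier_L1 g t"
    unfolding fourier_L1_def
  proof (rule integral_cong_AE)
    show "AE x in lebesgue. exp (- \<i> * of_real (x * t)) * f x = exp (- \<i> * of_real (x * t)) * g x"
      using assms(1) by eventually_elim simp
  qed measurable
qed

lemma borel_measurable_fourier_L1 [measurable]:
  assumes [measurable]: "f \<in> borel_measurable borel"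
  shows "fourier_L1 f \<in> borel_measurable borel"
  unfolding fourier_L1_borel[OF assms, abs_def] by measurable

lemma integrable_exp_times:
  fixes f :: "real \<Rightarrow> complex"
  assumes "integrable lborel f"
  shows "integrable lborel (\<lambda>x. exp (- \<i> * of_real (x * t)) * f x)"
proof (rule Bochner_Integration.integrable_bound[OF assms])
  have [measurable]: "f \<in> borel_measurable borel" using assms by simp
  show "(\<lambda>x. exp (- \<i> * of_real (x * t)) * f x) \<in> borel_measurable lborel" by measurable
qed (simp add: norm_mult)

lemma fourier_L1_diff:
  assumes "integrable lborel f" "integrable lborel g"
  shows "fourier_L1 (\<lambda>x. f x - g x) t = fourier_L1 f t - fourier_L1 g t"
proof -
  have "f \<in> borel_measurable borel" "g \<in> borel_measurable borel"
    using assms by simp_all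
  then show ?thesis
    using Bochner_Integration.integral_diff[OF integrable_exp_times[OF assms(1)]
        integrable_exp_times[OF assms(2)], of t t]
    by (simp only: fourier_L1_borel borel_measurable_diff right_diff_distrib)
qed

lemma norm_fourier_L1_le_nn:
  assumes "f \<in> borel_measurable borel"
  shows "ennreal (norm (fourier_L1 f t)) \<le> (\<integral>\<^sup>+x. norm (f x) \<partial>lborel)"
  unfolding fourier_L1_borel[OF assms]
  by (rule order_trans[OF ennreal_norm_integral_le]) (simp add: norm_mult)

lemma norm_fourier_L1_le:
  assumes "integrable lborel f"
  shows "norm (fourier_L1 f t) \<le> (LINT x|lborel. norm (f x))"
proof -
  have "ennreal (norm (fourier_L1 f t)) \<le> (\<integral>\<^sup>+x. norm (f x) \<partial>lborel)"
    using assms by (intro norm_fourier_L1_le_nn) simp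
  also have "\<dots> = ennreal (LINT x|lborel. norm (f x))"
    using assms by (intro nn_integral_eq_integral) auto
  finally show ?thesis by (simp add: integral_nonneg_AE)
qed

text \<open>Justifies the two exchanges of integration in the Plancherel argument; \<open>u\<close>
  stands for the oscillating exponentials, which are bounded but not integrable.\<close>

lemma integrable_pair_bounded:
  fixes a b :: "real \<Rightarrow> complex" and u :: "real \<Rightarrow> real \<Rightarrow> complex"
  assumes a: "integrable lborel a" and b: "integrable lborel b"
    and u[measurable]: "case_prod u \<in> borel_measurable (borel \<Otimes>\<^sub>M borel)"
    and u1: "\<And>x y. norm (u x y) \<le> 1"
  shows "integrable (lborel \<Otimes>\<^sub>M lborel) (\<lambda>(x, y). u x y * (a x * b y))"
proof (rule integrableI_bounded)
  have [measurable]: "a \<in> borel_measurable borel" "b \<in> borel_measurable borel"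
    using a b by simp_all
  show "(\<lambda>(x, y). u x y * (a x * b y)) \<in> borel_measurable (lborel \<Otimes>\<^sub>M lborel)"
    by measurable
  have "(\<integral>\<^sup>+z. ennreal (norm (case z of (x, y) \<Rightarrow> u x y * (a x * b y))) \<partial>(lborel \<Otimes>\<^sub>M lborel))
      \<le> (\<integral>\<^sup>+z. (case z of (x, y) \<Rightarrow> ennreal (norm (a x)) * ennreal (norm (b y))) \<partial>(lborel \<Otimes>\<^sub>M lborel))"
  proof (intro nn_integral_mono)
    fix z :: "real \<times> real"
    show "ennreal (norm (case z of (x, y) \<Rightarrow> u x y * (a x * b y)))
        \<le> (case z of (x, y) \<Rightarrow> ennreal (norm (a x)) * ennreal (norm (b y)))"
      using u1 by (auto split: prod.split simp: norm_mult mult_left_le_one_le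
          simp flip: ennreal_mult intro!: ennreal_leI)
  qed
  also have "\<dots> = (\<integral>\<^sup>+x. \<integral>\<^sup>+y. ennreal (norm (a x)) * ennreal (norm (b y)) \<partial>lborel \<partial>lborel)"
    by (subst lborel.nn_integral_fst[symmetric]) (auto simp: split_beta')
  also have "\<dots> = (\<integral>\<^sup>+x. ennreal (norm (a x)) \<partial>lborel) * (\<integral>\<^sup>+x. ennreal (norm (b x)) \<partial>lborel)"
    by (simp add: nn_integral_cmult nn_integral_multc)
  also have "\<dots> < \<infinity>"
    using a b by (simp add: integrable_iff_bounded ennreal_mult_less_top)
  finally show "(\<integral>\<^sup>+z. ennreal (norm (case z of (x, y) \<Rightarrow> u x y * (a x * b y))) \<partial>(lborel \<Otimes>\<^sub>M lborel)) < \<infinity>" .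
qed

text \<open>The characteristic function of the standard normal distribution, rescaled by
  \<open>x = e * t\<close>. Writing the result as \<open>2 * pi\<close> times a density exposes a
  kernel of total mass 1; the factor \<open>2 * pi\<close> becomes the Plancherel constant of this
  normalisation of the transform.\<close>

lemma gaussian_fourier:
  assumes e: "0 < e"
  shows "(LINT t|lborel. exp (\<i> * of_real (z * t)) * of_real (exp (- (e * t)\<^sup>2 / 2)))
    = complex_of_real (2 * pi * normal_density 0 e z)"
proof -
  have "complex_of_real (exp (- ((z / e)\<^sup>2) / 2)) = char std_normal_distribution (z / e)"
    by (simp add: char_std_normal_distribution)
  also have "\<dots> = (LINT x|lborel. std_normal_density x *\<^sub>R iexp (z / e * x))"
    unfolding char_def by (subst integral_density) auto
  also have "\<dots> = e *\<^sub>R (LINT t|lborel. std_normal_density (e * t) *\<^sub>R iexp (z / e * (e * t)))"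
    using e by (subst lborel_integral_real_affine[where c = e and t = 0]) auto
  also have "(LINT t|lborel. std_normal_density (e * t) *\<^sub>R iexp (z / e * (e * t)))
      = (LINT t|lborel. (1 / sqrt (2 * pi)) *\<^sub>R (exp (\<i> * of_real (z * t)) * of_real (exp (- (e * t)\<^sup>2 / 2))))"
    using e by (intro Bochner_Integration.integral_cong)
      (auto simp: std_normal_density_def scaleR_conv_of_real mult_ac)
  also have "\<dots> = (1 / sqrt (2 * pi)) *\<^sub>R (LINT t|lborel. exp (\<i> * of_real (z * t)) * of_real (exp (- (e * t)\<^sup>2 / 2)))"
    by (rule integral_scaleR_right)
  finally have "complex_of_real (exp (- ((z / e)\<^sup>2) / 2)) =
      (e / sqrt (2 * pi)) *\<^sub>R (LINT t|lborel. exp (\<i> * of_real (z * t)) * of_real (exp (- (e * t)\<^sup>2 / 2)))"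
    by simp
  then have "(sqrt (2 * pi) / e) *\<^sub>R complex_of_real (exp (- ((z / e)\<^sup>2) / 2)) =
      (LINT t|lborel. exp (\<i> * of_real (z * t)) * of_real (exp (- (e * t)\<^sup>2 / 2)))"
    using e by simp
  moreover have "sqrt (2 * pi) / e * exp (- ((z / e)\<^sup>2) / 2) = 2 * pi * normal_density 0 e z"
  proof -
    have "sqrt (2 * pi) * sqrt (2 * pi) = 2 * pi" by simp
    then have "sqrt (2 * pi) / e = 2 * pi / sqrt (2 * pi * e\<^sup>2)"
      using e by (simp add: real_sqrt_mult field_simps del: real_sqrt_mult_self)
    then show ?thesis
      using e by (simp add: normal_density_def power_divide mult_ac)
  qed
  ultimately show ?thesis
    by (metis scaleR_conv_of_real of_real_mult)
qed

lemma nn_integral_normal_density_shift: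
  assumes "0 < e"
  shows "(\<integral>\<^sup>+x. ennreal (normal_density 0 e (y - x)) \<partial>lborel) = 1"
    "(\<integral>\<^sup>+x. ennreal (normal_density 0 e (x - y)) \<partial>lborel) = 1"
proof -
  have 1: "(\<integral>\<^sup>+x. ennreal (normal_density 0 e x) \<partial>lborel) = 1"
    using assms by (subst nn_integral_eq_integral) auto
  show "(\<integral>\<^sup>+x. ennreal (normal_density 0 e (y - x)) \<partial>lborel) = 1"
    using nn_integral_real_affine[of "\<lambda>x. ennreal (normal_density 0 e x)" "-1" y] 1 by simp
  show "(\<integral>\<^sup>+x. ennreal (normal_density 0 e (x - y)) \<partial>lborel) = 1"
    using nn_integral_real_affine[of "\<lambda>x. ennreal (normal_density 0 e x)" 1 "-y"] 1 by simp
qed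

lemma integrable_gaussian:
  assumes "0 < e"
  shows "integrable lborel (\<lambda>t. complex_of_real (exp (- (e * t)\<^sup>2 / 2)))"
proof -
  have "integrable lborel (\<lambda>t. complex_of_real (sqrt (2 * pi) * std_normal_density (0 + e * t)))"
    using assms by (intro integrable_of_real integrable_mult_right lborel_integrable_real_affine) auto
  then show ?thesis
    by (simp add: std_normal_density_def)
qed

text \<open>The transform is so far only known to be bounded, so a Gaussian factor is inserted to
  make Fubini applicable. Expanding the square over \<open>x\<close> and \<open>y\<close> and
  integrating in \<open>t\<close> first leaves \<open>cnj (f y) * f x\<close> against
  \<open>2 * pi\<close> times a normal density in \<open>y - x\<close>. The right-hand side may be
  infinite.\<close>

lemma plancherel_gaussian:
  assumes f: "integrable lborel f" and e: "0 < e"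
  shows "(\<integral>\<^sup>+t. ennreal ((norm (fourier_L1 f t))\<^sup>2 * exp (- (e * t)\<^sup>2 / 2)) \<partial>lborel)
    \<le> ennreal (2 * pi) * (\<integral>\<^sup>+x. ennreal ((norm (f x))\<^sup>2) \<partial>lborel)"
proof -
  have fm[measurable]: "f \<in> borel_measurable borel" using f by simp
  let ?F = "fourier_L1 f" and ?G = "\<lambda>t. exp (- (e * t)\<^sup>2 / 2)"
  define M where "M = (LINT x|lborel. norm (f x))"
  have F_le: "norm (?F t) \<le> M" for t
    unfolding M_def by (rule norm_fourier_L1_le[OF f])
  have M: "0 \<le> M" unfolding M_def by simp
  note G = integrable_gaussian[OF e]
  have G': "integrable lborel ?G" using integrable_Re[OF G] by simp
  have FG: "integrable lborel (\<lambda>t. ?F t * of_real (?G t))"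
  proof (rule Bochner_Integration.integrable_bound[of _ "\<lambda>t. M * ?G t"])
    show "AE t in lborel. norm (?F t * of_real (?G t)) \<le> norm (M * ?G t)"
      using F_le M by (auto simp: norm_mult abs_mult intro!: mult_right_mono)
  qed (use G' in auto)
  have int: "integrable lborel (\<lambda>t. (norm (?F t))\<^sup>2 * ?G t)"
  proof (rule Bochner_Integration.integrable_bound[of _ "\<lambda>t. M\<^sup>2 * ?G t"])
    show "AE t in lborel. norm ((norm (?F t))\<^sup>2 * ?G t) \<le> norm (M\<^sup>2 * ?G t)"
      using F_le by (auto simp: abs_mult intro!: mult_right_mono power_mono)
  qed (use G' in auto)
  have cnjf: "integrable lborel (\<lambda>y. cnj (f y))" using f by simp
  have inner: "(LINT t|lborel. exp (\<i> * of_real (y * t)) * (?F t * of_real (?G t)))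
      = (LINT x|lborel. f x * of_real (2 * pi * normal_density 0 e (y - x)))" for y
  proof -
    let ?u = "\<lambda>x t. exp (\<i> * of_real (y * t)) * exp (- \<i> * of_real (x * t))"
    have "(LINT t|lborel. exp (\<i> * of_real (y * t)) * (?F t * of_real (?G t)))
        = (LINT t|lborel. (LINT x|lborel. ?u x t * (f x * of_real (?G t))))"
      unfolding fourier_L1_borel[OF fm]
      by (simp add: mult_ac del: of_real_mult flip: integral_mult_right_zero integral_mult_left_zero)
    also have "\<dots> = (LINT x|lborel. (LINT t|lborel. ?u x t * (f x * of_real (?G t))))"
      by (intro lborel_pair.Fubini_integral integrable_pair_bounded f G)
         (auto simp: norm_mult)
    also have "\<dots> = (LINT x|lborel. f x * (LINT t|lborel. exp (\<i> * of_real ((y - x) * t)) * of_real (?G t)))"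
    proof (intro Bochner_Integration.integral_cong refl)
      fix x
      have "(LINT t|lborel. ?u x t * (f x * of_real (?G t)))
          = (LINT t|lborel. f x * (exp (\<i> * of_real ((y - x) * t)) * of_real (?G t)))"
        by (intro Bochner_Integration.integral_cong refl)
           (simp add: algebra_simps exp_diff exp_minus field_simps)
      then show "(LINT t|lborel. ?u x t * (f x * of_real (?G t)))
          = f x * (LINT t|lborel. exp (\<i> * of_real ((y - x) * t)) * of_real (?G t))"
        by simp
    qed
    finally show ?thesis
      by (simp only: gaussian_fourier[OF e])
  qed
  have "of_real (LINT t|lborel. (norm (?F t))\<^sup>2 * ?G t)
      = (LINT t|lborel. cnj (?F t) * (?F t * of_real (?G t)))"
    by (subst integral_complex_of_real[symmetric], intro Bochner_Integration.integral_cong refl)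
       (simp only: of_real_mult complex_norm_square mult_ac)
  also have "\<dots> = (LINT t|lborel. (LINT y|lborel. exp (\<i> * of_real (y * t)) * (cnj (f y) * (?F t * of_real (?G t)))))"
  proof (intro Bochner_Integration.integral_cong refl)
    fix t
    have "cnj (?F t) = (LINT y|lborel. exp (\<i> * of_real (y * t)) * cnj (f y))"
      unfolding fourier_L1_borel[OF fm] Bochner_Integration.integral_cnj[symmetric]
      by (intro Bochner_Integration.integral_cong refl) (simp add: exp_cnj)
    then show "cnj (?F t) * (?F t * of_real (?G t))
        = (LINT y|lborel. exp (\<i> * of_real (y * t)) * (cnj (f y) * (?F t * of_real (?G t))))"
      by (simp add: mult.assoc flip: integral_mult_left_zero)
  qed
  also have "\<dots> = (LINT y|lborel. (LINT t|lborel. exp (\<i> * of_real (y * t)) * (cnj (f y) * (?F t * of_real (?G t)))))"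
    by (intro lborel_pair.Fubini_integral integrable_pair_bounded cnjf FG) auto
  also have "\<dots> = (LINT y|lborel. cnj (f y) * (LINT t|lborel. exp (\<i> * of_real (y * t)) * (?F t * of_real (?G t))))"
  proof (intro Bochner_Integration.integral_cong refl)
    fix y
    have "(LINT t|lborel. exp (\<i> * of_real (y * t)) * (cnj (f y) * (?F t * of_real (?G t))))
        = (LINT t|lborel. cnj (f y) * (exp (\<i> * of_real (y * t)) * (?F t * of_real (?G t))))"
      by (intro Bochner_Integration.integral_cong refl) (simp only: mult_ac)
    then show "(LINT t|lborel. exp (\<i> * of_real (y * t)) * (cnj (f y) * (?F t * of_real (?G t))))
        = cnj (f y) * (LINT t|lborel. exp (\<i> * of_real (y * t)) * (?F t * of_real (?G t)))"
      by (simp only: integral_mult_right_zero)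
  qed
  also have "\<dots> = (LINT y|lborel. cnj (f y) * (LINT x|lborel. f x * of_real (2 * pi * normal_density 0 e (y - x))))"
    by (simp only: inner)
  finally have eq: "complex_of_real (LINT t|lborel. (norm (?F t))\<^sup>2 * ?G t)
      = (LINT y|lborel. cnj (f y) * (LINT x|lborel. f x * of_real (2 * pi * normal_density 0 e (y - x))))" .
  let ?H = "normal_density 0 e" and ?I = "\<integral>\<^sup>+x. ennreal ((norm (f x))\<^sup>2) \<partial>lborel"
  have "(\<integral>\<^sup>+t. ennreal ((norm (?F t))\<^sup>2 * ?G t) \<partial>lborel) = ennreal (LINT t|lborel. (norm (?F t))\<^sup>2 * ?G t)"
    using int by (intro nn_integral_eq_integral) auto
  also have "\<dots> \<le> ennreal (norm (complex_of_real (LINT t|lborel. (norm (?F t))\<^sup>2 * ?G t)))"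
    by (intro ennreal_leI) simp
  also have "\<dots> \<le> (\<integral>\<^sup>+y. norm (cnj (f y) * (LINT x|lborel. f x * of_real (2 * pi * ?H (y - x)))) \<partial>lborel)"
    unfolding eq by (rule ennreal_norm_integral_le)
  also have "\<dots> \<le> (\<integral>\<^sup>+y. \<integral>\<^sup>+x. ennreal pi * (ennreal ((norm (f y))\<^sup>2) * ennreal (?H (y - x))
      + ennreal ((norm (f x))\<^sup>2) * ennreal (?H (y - x))) \<partial>lborel \<partial>lborel)"
  proof (intro nn_integral_mono)
    fix y
    have "ennreal (norm (cnj (f y) * (LINT x|lborel. f x * of_real (2 * pi * ?H (y - x)))))
        \<le> ennreal (norm (f y)) * (\<integral>\<^sup>+x. norm (f x * of_real (2 * pi * ?H (y - x))) \<partial>lborel)"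
      unfolding norm_mult[of "cnj (f y)"] complex_mod_cnj ennreal_mult[OF norm_ge_zero norm_ge_zero]
      by (intro mult_left_mono ennreal_norm_integral_le) simp
    also have "\<dots> = (\<integral>\<^sup>+x. ennreal (norm (f y)) * norm (f x * of_real (2 * pi * ?H (y - x))) \<partial>lborel)"
      by (rule nn_integral_cmult[symmetric]) measurable
    also have "\<dots> \<le> (\<integral>\<^sup>+x. ennreal pi * (ennreal ((norm (f y))\<^sup>2) * ennreal (?H (y - x))
      + ennreal ((norm (f x))\<^sup>2) * ennreal (?H (y - x))) \<partial>lborel)"
    proof (intro nn_integral_mono)
      fix x
      \<comment> \<open>This splits the product symmetrically. Each half carries a factor
        \<open>pi\<close> and, the density having mass 1 in either variable, integrates to
        \<open>pi\<close> times the integral of \<open>(norm (f x))\<^sup>2\<close>, so no constant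
        is lost.\<close>
      have "2 * norm (f y) * norm (f x) \<le> (norm (f y))\<^sup>2 + (norm (f x))\<^sup>2"
        by (rule sum_squares_bound)
      then have "(pi * ?H (y - x)) * (2 * norm (f y) * norm (f x))
          \<le> (pi * ?H (y - x)) * ((norm (f y))\<^sup>2 + (norm (f x))\<^sup>2)"
        by (rule mult_left_mono) simp
      then have "norm (f y) * norm (f x * of_real (2 * pi * ?H (y - x)))
          \<le> pi * ((norm (f y))\<^sup>2 * ?H (y - x) + (norm (f x))\<^sup>2 * ?H (y - x))"
        by (simp add: norm_mult algebra_simps)
      then show "ennreal (norm (f y)) * norm (f x * of_real (2 * pi * ?H (y - x)))
          \<le> ennreal pi * (ennreal ((norm (f y))\<^sup>2) * ennreal (?H (y - x))
             + ennreal ((norm (f x))\<^sup>2) * ennreal (?H (y - x)))"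
        by (simp add: ennreal_leI flip: ennreal_mult ennreal_plus)
    qed
    finally show "ennreal (norm (cnj (f y) * (LINT x|lborel. f x * of_real (2 * pi * ?H (y - x)))))
        \<le> (\<integral>\<^sup>+x. ennreal pi * (ennreal ((norm (f y))\<^sup>2) * ennreal (?H (y - x))
      + ennreal ((norm (f x))\<^sup>2) * ennreal (?H (y - x))) \<partial>lborel)" .
  qed
  also have "\<dots> = ennreal pi * ((\<integral>\<^sup>+y. \<integral>\<^sup>+x. ennreal ((norm (f y))\<^sup>2) * ennreal (?H (y - x)) \<partial>lborel \<partial>lborel)
      + (\<integral>\<^sup>+y. \<integral>\<^sup>+x. ennreal ((norm (f x))\<^sup>2) * ennreal (?H (y - x)) \<partial>lborel \<partial>lborel))"
    by (simp add: nn_integral_cmult nn_integral_add)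
  also have "(\<integral>\<^sup>+y. \<integral>\<^sup>+x. ennreal ((norm (f x))\<^sup>2) * ennreal (?H (y - x)) \<partial>lborel \<partial>lborel)
      = (\<integral>\<^sup>+x. \<integral>\<^sup>+y. ennreal ((norm (f x))\<^sup>2) * ennreal (?H (y - x)) \<partial>lborel \<partial>lborel)"
    by (rule lborel_pair.Fubini') measurable
  also have "\<dots> = ?I"
    by (simp add: nn_integral_cmult nn_integral_normal_density_shift e)
  also have "(\<integral>\<^sup>+y. \<integral>\<^sup>+x. ennreal ((norm (f y))\<^sup>2) * ennreal (?H (y - x)) \<partial>lborel \<partial>lborel) = ?I"
    by (simp add: nn_integral_cmult nn_integral_normal_density_shift e)
  also have "ennreal pi * (?I + ?I) = ennreal (2 * pi) * ?I"
    by (simp add: ennreal_mult mult_ac flip: mult_2)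
  finally show ?thesis .
qed

text \<open>Fatou's lemma removes the Gaussian factor of \<open>plancherel_gaussian\<close>, whose
  bound is uniform in \<open>e\<close>. An inequality suffices, since its purpose is continuity of
  the transform.\<close>

lemma plancherel_inequality:
  assumes f: "integrable lborel f"
  shows "power_integral 2 (fourier_L1 f) \<le> ennreal (2 * pi) * power_integral 2 f"
proof -
  have [measurable]: "f \<in> borel_measurable borel" using f by simp
  let ?F = "fourier_L1 f"
  let ?u = "\<lambda>n::nat. \<lambda>t. ennreal ((norm (?F t))\<^sup>2 * exp (- (1 / Suc n * t)\<^sup>2 / 2))"
  have "power_integral 2 ?F = (\<integral>\<^sup>+t. liminf (\<lambda>n. ?u n t) \<partial>lborel)"
    unfolding power_integral_def
  proof (intro nn_integral_cong)
    fix t :: real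
    have "(\<lambda>n. 1 / real (Suc n)) \<longlonglongrightarrow> 0"
      using LIMSEQ_inverse_real_of_nat by (simp add: inverse_eq_divide)
    then have "(\<lambda>n. (norm (?F t))\<^sup>2 * exp (- (1 / Suc n * t)\<^sup>2 / 2)) \<longlonglongrightarrow> (norm (?F t))\<^sup>2 * exp (- (0 * t)\<^sup>2 / 2)"
      by (intro tendsto_intros) auto
    from lim_imp_Liminf[OF _ tendsto_ennrealI[OF this]]
    show "ennreal (norm (?F t) powr 2) = liminf (\<lambda>n. ?u n t)"
      by simp
  qed
  also have "\<dots> \<le> liminf (\<lambda>n. \<integral>\<^sup>+t. ?u n t \<partial>lborel)"
    by (rule nn_integral_liminf) measurable
  also have "\<dots> \<le> limsup (\<lambda>n. \<integral>\<^sup>+t. ?u n t \<partial>lborel)"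
    by (intro Liminf_le_Limsup) simp
  also have "\<dots> \<le> ennreal (2 * pi) * (\<integral>\<^sup>+x. ennreal ((norm (f x))\<^sup>2) \<partial>lborel)"
    by (intro Limsup_bounded always_eventually allI plancherel_gaussian[OF f]) simp
  also have "(\<integral>\<^sup>+x. ennreal ((norm (f x))\<^sup>2) \<partial>lborel) = power_integral 2 f"
    unfolding power_integral_def by simp
  finally show ?thesis .
qed

subsection \<open>Hausdorff-Young inequality\<close>

lemma nn_integral_powr_from_0:
  fixes a c :: real
  assumes "-1 < a" "0 \<le> c"
  shows "(\<integral>\<^sup>+s. ennreal (s powr a) * indicator {0..c} s \<partial>lborel) = ennreal (c powr (a + 1) / (a + 1))"
  using assms by (intro nn_integral_has_integral_lebesgue' has_integral_powr_from_0) auto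

text \<open>Above the threshold, \<open>1 < s * norm (f x) powr (p - 1) / (2 * A)\<close>;
  multiplying by \<open>norm (f x)\<close> bounds it by
  \<open>s / (2 * A) * norm (f x) powr p\<close>. So the discarded part has L^1 norm, hence
  transform, at most \<open>s / 2\<close>. Writing the threshold without a quotient makes
  \<open>s = 0\<close> harmless.\<close>

lemma fourier_L1_split_large:
  fixes f :: "real \<Rightarrow> complex"
  assumes f: "integrable lborel f" and A: "0 < A" and s: "0 \<le> s"
    and fA: "power_integral p f \<le> ennreal A"
  defines "g \<equiv> \<lambda>x. if s * norm (f x) powr (p - 1) \<le> 2 * A then f x else 0"
  shows "norm (fourier_L1 f t) \<le> norm (fourier_L1 g t) + s / 2"
proof -
  have [measurable]: "f \<in> borel_measurable borel" using f by simp
  have gm: "g \<in> borel_measurable borel" unfolding g_def by measurable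
  have g: "integrable lborel g"
    by (rule Bochner_Integration.integrable_bound[OF f]) (use gm in \<open>auto simp: g_def\<close>)
  have "ennreal (norm (fourier_L1 (\<lambda>x. f x - g x) t)) \<le> (\<integral>\<^sup>+x. norm (f x - g x) \<partial>lborel)"
    using gm by (intro norm_fourier_L1_le_nn) measurable
  also have "\<dots> \<le> (\<integral>\<^sup>+x. ennreal (s / (2 * A)) * ennreal (norm (f x) powr p) \<partial>lborel)"
  proof (intro nn_integral_mono)
    fix x
    have "norm (f x - g x) \<le> s / (2 * A) * norm (f x) powr p"
    proof (cases "s * norm (f x) powr (p - 1) \<le> 2 * A \<or> f x = 0")
      case True
      then show ?thesis using s A by (auto simp: g_def)
    next
      case False
      then have "1 \<le> s * norm (f x) powr (p - 1) / (2 * A)"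
        using A by (simp add: field_simps)
      then have "norm (f x) * 1 \<le> norm (f x) * (s * norm (f x) powr (p - 1) / (2 * A))"
        by (intro mult_left_mono) auto
      also have "\<dots> = s / (2 * A) * (norm (f x) powr 1 * norm (f x) powr (p - 1))"
        using False by simp
      also have "norm (f x) powr 1 * norm (f x) powr (p - 1) = norm (f x) powr p"
        by (simp only: powr_add[symmetric]) simp
      finally show ?thesis using False by (simp add: g_def)
    qed
    then show "ennreal (norm (f x - g x)) \<le> ennreal (s / (2 * A)) * ennreal (norm (f x) powr p)"
      using s A by (simp add: ennreal_leI flip: ennreal_mult)
  qed
  also have "\<dots> = ennreal (s / (2 * A)) * power_integral p f"
    unfolding power_integral_def by (simp add: nn_integral_cmult)
  also have "\<dots> \<le> ennreal (s / (2 * A)) * ennreal A"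
    by (intro mult_left_mono fA) simp
  also have "\<dots> = ennreal (s / 2)"
    using s A by (simp flip: ennreal_mult)
  finally have "norm (fourier_L1 f t - fourier_L1 g t) \<le> s / 2"
    using s by (simp add: fourier_L1_diff f g)
  then show ?thesis
    using norm_triangle_ineq2[of "fourier_L1 f t" "fourier_L1 g t"] by linarith
qed

text \<open>
  Marcinkiewicz interpolation: at level \<open>s\<close> the function is cut at the height for which the part
  above it has \<open>L\<^sup>1\<close> norm at most \<open>s / 2\<close>, so that the Plancherel inequality for the part below
  controls the set where the transform exceeds \<open>s\<close>.
\<close>

lemma hausdorff_young_bound:
  assumes p: "1 < p" "p < 2" and q: "q = p / (p - 1)"
    and f: "integrable lborel f" and A: "0 < A" and fA: "power_integral p f \<le> ennreal A"
  shows "power_integral q (fourier_L1 f)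
    \<le> ennreal (8 * pi * q * 2 powr (q - 2) / (q - 2) * A powr (q - 1))"
proof -
  have q2: "2 < q" using p by (simp add: q field_simps)
  have fm[measurable]: "f \<in> borel_measurable borel" using f by simp
  define g where "g = (\<lambda>s x. if s * norm (f x) powr (p - 1) \<le> 2 * A then f x else 0)"
  have gm[measurable]: "(\<lambda>(s, x). g s x) \<in> borel_measurable (borel \<Otimes>\<^sub>M borel)"
    unfolding g_def split_beta' by measurable
  let ?F = "fourier_L1 f" and ?G = "\<lambda>s. fourier_L1 (g s)"
  have g: "integrable lborel (g s)" for s
    by (rule Bochner_Integration.integrable_bound[OF f]) (auto simp: g_def)
  have G_eq: "?G s t = (LINT x|lborel. exp (- \<i> * of_real (x * t)) * g s x)" for s t
    by (rule fourier_L1_borel) measurable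
  have G[measurable]: "(\<lambda>(s, t). ?G s t) \<in> borel_measurable (borel \<Otimes>\<^sub>M borel)"
    unfolding G_eq split_beta' by measurable
  let ?w = "\<lambda>s. ennreal (s powr (q - 3)) * indicator {0..} s"
  have "power_integral q ?F \<le> (\<integral>\<^sup>+t. \<integral>\<^sup>+s. ennreal (4 * q) * (?w s * ennreal ((norm (?G s t))\<^sup>2)) \<partial>lborel \<partial>lborel)"
    unfolding power_integral_def
  proof (intro nn_integral_mono)
    fix t :: real
    \<comment> \<open>Layer-cake representation: \<open>a powr q\<close> is \<open>q\<close> times
      the integral of \<open>s powr (q - 1)\<close> over \<open>0 \<le> s \<le> a\<close>. On that
      range \<open>s / 2 \<le> norm (?G s t)\<close>, which trades \<open>s powr (q - 1)\<close> for
      \<open>4 * s powr (q - 3)\<close> times the square of \<open>norm (?G s t)\<close>, a quantity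
      that the Plancherel inequality can integrate in \<open>t\<close>.\<close>
    have "ennreal (norm (?F t) powr q) = ennreal q * ennreal (norm (?F t) powr (q - 1 + 1) / (q - 1 + 1))"
      using q2 by (simp flip: ennreal_mult)
    also have "\<dots> = ennreal q * (\<integral>\<^sup>+s. ennreal (s powr (q - 1)) * indicator {0..norm (?F t)} s \<partial>lborel)"
      using q2 by (subst nn_integral_powr_from_0) auto
    also have "\<dots> = (\<integral>\<^sup>+s. ennreal q * (ennreal (s powr (q - 1)) * indicator {0..norm (?F t)} s) \<partial>lborel)"
      by (rule nn_integral_cmult[symmetric]) measurable
    also have "\<dots> \<le> (\<integral>\<^sup>+s. ennreal (4 * q) * (?w s * ennreal ((norm (?G s t))\<^sup>2)) \<partial>lborel)"
    proof (intro nn_integral_mono)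
      fix s :: real
      show "ennreal q * (ennreal (s powr (q - 1)) * indicator {0..norm (?F t)} s)
          \<le> ennreal (4 * q) * (?w s * ennreal ((norm (?G s t))\<^sup>2))"
      proof (cases "s \<in> {0..norm (?F t)}")
        case True
        then have "s / 2 \<le> norm (?G s t)"
          using fourier_L1_split_large[OF f A _ fA, of s t] by (simp add: g_def)
        then have "(s / 2)\<^sup>2 \<le> (norm (?G s t))\<^sup>2"
          using True by (intro power_mono) auto
        then have "s powr (q - 3) * s\<^sup>2 \<le> s powr (q - 3) * (4 * (norm (?G s t))\<^sup>2)"
          by (intro mult_left_mono) (auto simp: power_divide)
        also have "s powr (q - 3) * s\<^sup>2 = s powr (q - 1)"
          using True by (cases "s = 0") (auto simp flip: powr_add simp: powr_numeral[symmetric] simp del: powr_numeral)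
        finally have "q * s powr (q - 1) \<le> q * (s powr (q - 3) * (4 * (norm (?G s t))\<^sup>2))"
          using q2 by (intro mult_left_mono) auto
        then have "q * s powr (q - 1) \<le> 4 * q * (s powr (q - 3) * (norm (?G s t))\<^sup>2)"
          by (simp add: algebra_simps)
        then have "ennreal (q * s powr (q - 1)) \<le> ennreal (4 * q * (s powr (q - 3) * (norm (?G s t))\<^sup>2))"
          by (rule ennreal_leI)
        then show ?thesis
          using True q2 by (simp add: ennreal_mult)
      qed simp
    qed
    finally show "ennreal (norm (?F t) powr q)
        \<le> (\<integral>\<^sup>+s. ennreal (4 * q) * (?w s * ennreal ((norm (?G s t))\<^sup>2)) \<partial>lborel)" .
  qed
  also have "\<dots> = (\<integral>\<^sup>+s. \<integral>\<^sup>+t. ennreal (4 * q) * (?w s * ennreal ((norm (?G s t))\<^sup>2)) \<partial>lborel \<partial>lborel)"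
    by (rule lborel_pair.Fubini') measurable
  also have "\<dots> = (\<integral>\<^sup>+s. ennreal (4 * q) * (?w s * power_integral 2 (?G s)) \<partial>lborel)"
    unfolding power_integral_def by (simp add: nn_integral_cmult)
  also have "\<dots> \<le> (\<integral>\<^sup>+s. ennreal (4 * q) * (?w s * (ennreal (2 * pi) * power_integral 2 (g s))) \<partial>lborel)"
    by (intro nn_integral_mono mult_left_mono plancherel_inequality g) auto
  also have "\<dots> = (\<integral>\<^sup>+s. \<integral>\<^sup>+x. ennreal (8 * pi * q) * (?w s * ennreal ((norm (g s x))\<^sup>2)) \<partial>lborel \<partial>lborel)"
  proof (intro nn_integral_cong)
    fix s :: real
    have "ennreal (4 * q) * ennreal (2 * pi) = ennreal (8 * pi * q)"
      using q2 by (subst ennreal_mult[symmetric]) (auto simp: algebra_simps)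
    then have "ennreal (4 * q) * (?w s * (ennreal (2 * pi) * power_integral 2 (g s)))
        = ennreal (8 * pi * q) * (?w s * power_integral 2 (g s))"
      by (metis mult.assoc mult.left_commute)
    also have "\<dots> = (\<integral>\<^sup>+x. ennreal (8 * pi * q) * (?w s * ennreal ((norm (g s x))\<^sup>2)) \<partial>lborel)"
      unfolding power_integral_def by (simp add: nn_integral_cmult)
    finally show "ennreal (4 * q) * (?w s * (ennreal (2 * pi) * power_integral 2 (g s)))
        = (\<integral>\<^sup>+x. ennreal (8 * pi * q) * (?w s * ennreal ((norm (g s x))\<^sup>2)) \<partial>lborel)" .
  qed
  also have "\<dots> = (\<integral>\<^sup>+x. \<integral>\<^sup>+s. ennreal (8 * pi * q) * (?w s * ennreal ((norm (g s x))\<^sup>2)) \<partial>lborel \<partial>lborel)"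
    by (rule lborel_pair.Fubini') measurable
  also have "\<dots> \<le> (\<integral>\<^sup>+x. ennreal (8 * pi * q * (2 * A) powr (q - 2) / (q - 2)) * ennreal (norm (f x) powr p) \<partial>lborel)"
  proof (intro nn_integral_mono)
    fix x :: real
    let ?a = "norm (f x)"
    show "(\<integral>\<^sup>+s. ennreal (8 * pi * q) * (?w s * ennreal ((norm (g s x))\<^sup>2)) \<partial>lborel)
        \<le> ennreal (8 * pi * q * (2 * A) powr (q - 2) / (q - 2)) * ennreal (?a powr p)"
    proof (cases "f x = 0")
      case False
      then have a: "0 < ?a" by simp
      \<comment> \<open>The threshold condition solved for \<open>s\<close>. The integral of
        \<open>s powr (q - 3)\<close> from 0 to this level converges because \<open>q > 2\<close>,
        that is, \<open>p < 2\<close>.\<close>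
      let ?c = "2 * A * ?a powr (1 - p)"
      have "(\<integral>\<^sup>+s. ennreal (8 * pi * q) * (?w s * ennreal ((norm (g s x))\<^sup>2)) \<partial>lborel)
          \<le> (\<integral>\<^sup>+s. ennreal (8 * pi * q * ?a\<^sup>2) * (ennreal (s powr (q - 3)) * indicator {0..?c} s) \<partial>lborel)"
      proof (intro nn_integral_mono)
        fix s :: real
        show "ennreal (8 * pi * q) * (?w s * ennreal ((norm (g s x))\<^sup>2))
            \<le> ennreal (8 * pi * q * ?a\<^sup>2) * (ennreal (s powr (q - 3)) * indicator {0..?c} s)"
        proof (cases "0 \<le> s \<and> s * ?a powr (p - 1) \<le> 2 * A")
          case True
          then have "s * (?a powr (p - 1) * ?a powr (1 - p)) \<le> ?c"
            unfolding mult.assoc[symmetric] by (intro mult_right_mono) auto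
          then have "s \<in> {0..?c}"
            using True a by (simp flip: powr_add)
          then show ?thesis
            using True q2 by (simp add: g_def ennreal_mult mult_ac)
        qed (auto simp: g_def indicator_def)
      qed
      also have "\<dots> = ennreal (8 * pi * q * ?a\<^sup>2) * ennreal (?c powr (q - 3 + 1) / (q - 3 + 1))"
        using q2 A by (subst nn_integral_cmult, measurable) (subst nn_integral_powr_from_0, auto)
      also have "\<dots> = ennreal (8 * pi * q * ?a\<^sup>2 * (?c powr (q - 2) / (q - 2)))"
        using q2 by (subst ennreal_mult[symmetric]) auto
      also have "8 * pi * q * ?a\<^sup>2 * (?c powr (q - 2) / (q - 2))
          = 8 * pi * q * (2 * A) powr (q - 2) / (q - 2) * ?a powr p"
      proof -
        \<comment> \<open>Conjugacy of \<open>q\<close> enters here: it is the exponent for which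
          the powers of \<open>norm (f x)\<close> combine into
          \<open>norm (f x) powr p\<close>.\<close>
        have "2 + (1 - p) * (q - 2) = p"
          using p by (simp add: q field_simps)
        then have "?a powr 2 * ?a powr ((1 - p) * (q - 2)) = ?a powr p"
          by (simp only: powr_add[symmetric])
        then have "?a\<^sup>2 * ?c powr (q - 2) = (2 * A) powr (q - 2) * ?a powr p"
          using A a by (simp add: powr_mult powr_powr mult_ac)
        then have "8 * pi * q / (q - 2) * (?a\<^sup>2 * ?c powr (q - 2))
            = 8 * pi * q / (q - 2) * ((2 * A) powr (q - 2) * ?a powr p)"
          by (rule arg_cong)
        then show ?thesis
          by (simp add: mult_ac)
      qed
      also have "ennreal (8 * pi * q * (2 * A) powr (q - 2) / (q - 2) * ?a powr p)
          = ennreal (8 * pi * q * (2 * A) powr (q - 2) / (q - 2)) * ennreal (?a powr p)"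
        using q2 by (intro ennreal_mult) auto
      finally show ?thesis .
    qed (simp add: g_def)
  qed
  also have "\<dots> = ennreal (8 * pi * q * (2 * A) powr (q - 2) / (q - 2)) * power_integral p f"
    unfolding power_integral_def by (simp add: nn_integral_cmult)
  also have "\<dots> \<le> ennreal (8 * pi * q * (2 * A) powr (q - 2) / (q - 2)) * ennreal A"
    by (intro mult_left_mono fA) simp
  also have "\<dots> = ennreal (8 * pi * q * (2 * A) powr (q - 2) / (q - 2) * A)"
    using q2 A by (subst ennreal_mult[symmetric]) auto
  also have "8 * pi * q * (2 * A) powr (q - 2) / (q - 2) * A
      = 8 * pi * q * 2 powr (q - 2) / (q - 2) * A powr (q - 1)"
  proof -
    have "A powr (q - 2) * A powr 1 = A powr (q - 1)"
      by (simp only: powr_add[symmetric]) simp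
    then show ?thesis
      using A by (simp add: powr_mult mult_ac)
  qed
  finally show ?thesis .
qed

text \<open>Since \<open>q = p * (q - 1)\<close>, the exponent \<open>q - 1\<close> of
  \<open>A\<close> is the homogeneous one. The constant is uniform in \<open>f\<close>, as the
  continuity arguments require. The endpoint \<open>p = 2\<close> is separate because the factor
  \<open>1 / (q - 2)\<close> from interpolation blows up there.\<close>

lemma hausdorff_young:
  assumes p: "1 < p" "p \<le> 2" and q: "q = p / (p - 1)"
  obtains C where "0 \<le> C" "\<And>f A. integrable lborel f \<Longrightarrow> 0 < A \<Longrightarrow>
    power_integral p f \<le> ennreal A \<Longrightarrow> power_integral q (fourier_L1 f) \<le> ennreal (C * A powr (q - 1))"
proof (cases "p = 2")
  case True
  show thesis
  proof
    show "0 \<le> 2 * pi" by simp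
    fix f :: "real \<Rightarrow> complex" and A :: real
    assume "integrable lborel f" "0 < A" and A: "power_integral p f \<le> ennreal A"
    then have "power_integral q (fourier_L1 f) \<le> ennreal (2 * pi) * power_integral 2 f"
      using True q plancherel_inequality by simp
    also have "\<dots> \<le> ennreal (2 * pi) * ennreal A"
      using A True by (intro mult_left_mono) auto
    also have "\<dots> = ennreal (2 * pi * A powr (q - 1))"
      using True q \<open>0 < A\<close> by (subst ennreal_mult[symmetric]) auto
    finally show "power_integral q (fourier_L1 f) \<le> ennreal (2 * pi * A powr (q - 1))" .
  qed
next
  case False
  with p have p': "p < 2" by simp
  then have "2 < q" using p by (simp add: q field_simps)
  show thesis
  proof
    show "0 \<le> 8 * pi * q * 2 powr (q - 2) / (q - 2)"
      using \<open>2 < q\<close> by simp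
  qed (rule hausdorff_young_bound[OF p(1) p' q])
qed

lemma hausdorff_young_finite:
  assumes p: "1 < p" "p \<le> 2" and q: "q = p / (p - 1)"
    and f: "integrable lborel f" and fin: "power_integral p f < \<infinity>"
  shows "power_integral q (fourier_L1 f) < \<infinity>"
proof -
  obtain C where C: "0 \<le> C" "\<And>f A. integrable lborel f \<Longrightarrow> 0 < A \<Longrightarrow>
    power_integral p f \<le> ennreal A \<Longrightarrow> power_integral q (fourier_L1 f) \<le> ennreal (C * A powr (q - 1))"
    using hausdorff_young[OF p q] by metis
  let ?A = "enn2real (power_integral p f) + 1"
  have "power_integral p f \<le> ennreal ?A"
    using fin by (simp add: ennreal_plus del: ennreal_1)
  then have "power_integral q (fourier_L1 f) \<le> ennreal (C * ?A powr (q - 1))"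
    by (intro C f) (auto simp: add_nonneg_pos)
  then show ?thesis
    by (auto intro: order_le_less_trans)
qed

text \<open>Continuity of the transform from L^p to L^q. The filter is arbitrary because the Cauchy
  property of the cutoffs is a limit along a product of two copies of \<open>at_top\<close>.\<close>

lemma hausdorff_young_tendsto:
  assumes p: "1 < p" "p \<le> 2" and q: "q = p / (p - 1)"
    and F: "\<And>i. integrable lborel (F i)"
    and lim: "((\<lambda>i. power_integral p (F i)) \<longlongrightarrow> 0) L"
  shows "((\<lambda>i. power_integral q (fourier_L1 (F i))) \<longlongrightarrow> 0) L"
proof (rule order_tendstoI)
  obtain C where C: "0 \<le> C" "\<And>f A. integrable lborel f \<Longrightarrow> 0 < A \<Longrightarrow>
    power_integral p f \<le> ennreal A \<Longrightarrow> power_integral q (fourier_L1 f) \<le> ennreal (C * A powr (q - 1))"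
    using hausdorff_young[OF p q] by metis
  have q1: "0 < q - 1" using p by (simp add: q field_simps)
  fix e :: ennreal assume e: "0 < e"
  have "((\<lambda>A. ennreal (C * A powr (q - 1))) \<longlongrightarrow> ennreal (C * 0 powr (q - 1))) (at_right 0)"
    using q1 by (intro tendsto_ennrealI tendsto_intros tendsto_powr') (auto simp: eventually_at_filter)
  then have "((\<lambda>A. ennreal (C * A powr (q - 1))) \<longlongrightarrow> 0) (at_right 0)" by simp
  then have "\<forall>\<^sub>F A in at_right 0. ennreal (C * A powr (q - 1)) < e"
    using e by (rule order_tendstoD)
  moreover have "\<forall>\<^sub>F A in at_right (0::real). 0 < A"
    by (simp add: eventually_at_filter)
  ultimately obtain A :: real where A: "0 < A" "ennreal (C * A powr (q - 1)) < e"
    using eventually_happens[OF eventually_conj] trivial_limit_at_right_real by blast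
  have "\<forall>\<^sub>F i in L. power_integral p (F i) < ennreal A"
    using lim by (rule order_tendstoD) (use A in simp)
  then show "\<forall>\<^sub>F i in L. power_integral q (fourier_L1 (F i)) < e"
  proof eventually_elim
    case (elim i)
    then have "power_integral q (fourier_L1 (F i)) \<le> ennreal (C * A powr (q - 1))"
      using A F by (intro C) auto
    with A show ?case by simp
  qed
qed simp

subsection \<open>Integral operators with a dilation kernel\<close>

lemma AE_scale:
  fixes t :: real
  assumes "AE x in lebesgue. P x" "t \<noteq> 0"
  shows "AE u in lebesgue. P (t * u)"
proof -
  from assms have "AE x in lborel. P x" by (simp add: AE_completion_iff)
  then obtain N where N: "N \<in> null_sets lborel" "{x. \<not> P x} \<subseteq> N"
    by (auto elim!: AE_E simp: null_sets_def)
  have [measurable]: "N \<in> sets borel" using N by auto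
  have "(\<integral>\<^sup>+x. indicator N x \<partial>lborel) = \<bar>t\<bar> * (\<integral>\<^sup>+x. indicator N (0 + t * x) \<partial>lborel)"
    by (rule nn_integral_real_affine) (use assms in auto)
  moreover have "(\<integral>\<^sup>+x. indicator N x \<partial>lborel) = 0"
    using N by auto
  ultimately have "(\<integral>\<^sup>+x. indicator N (0 + t * x) \<partial>lborel) = 0"
    using assms by simp
  then have "AE x in lborel. indicator N (0 + t * x) = (0::ennreal)"
    by (subst (asm) nn_integral_0_iff_AE) measurable
  then have "AE u in lborel. P (t * u)"
    using N by (auto elim!: eventually_mono simp: indicator_def split: if_splits)
  then show ?thesis by (simp add: AE_completion_iff)
qed

text \<open>The kernel is left general so that truncated kernels and differences of kernels fall
  under the same estimates.\<close>

definition kernel_op :: "(real \<Rightarrow> real) \<Rightarrow> (real \<Rightarrow> complex) \<Rightarrow> real \<Rightarrow> complex" where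
  "kernel_op k f t = (LINT u:{0<..}|lborel. k u *\<^sub>R f (t * u))"

definition kernel_converges :: "(real \<Rightarrow> real) \<Rightarrow> (real \<Rightarrow> complex) \<Rightarrow> real \<Rightarrow> bool" where
  "kernel_converges k f t \<longleftrightarrow> set_integrable lborel {0<..} (\<lambda>u. k u *\<^sub>R f (t * u))"

text \<open>Dilating the argument of \<open>f\<close> by \<open>u\<close> multiplies its L^p norm by
  \<open>u powr (- 1 / p)\<close>. For a nonnegative kernel this is therefore the bound that
  Minkowski's integral inequality gives for the operator norm on L^p.\<close>

definition kernel_moment :: "real \<Rightarrow> (real \<Rightarrow> real) \<Rightarrow> ennreal" where
  "kernel_moment p k = (\<integral>\<^sup>+u. ennreal (k u * u powr (- 1 / p)) * indicator {0<..} u \<partial>lborel)"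

lemma borel_measurable_kernel_op [measurable]:
  assumes [measurable]: "k \<in> borel_measurable borel" "f \<in> borel_measurable borel"
  shows "kernel_op k f \<in> borel_measurable borel"
  unfolding kernel_op_def[abs_def] set_lebesgue_integral_def by measurable

lemma kernel_op_diff:
  assumes "kernel_converges k f t" "kernel_converges k g t"
  shows "kernel_op k (\<lambda>x. f x - g x) t = kernel_op k f t - kernel_op k g t"
  using set_integral_diff(2)[OF assms[unfolded kernel_converges_def]]
  by (simp add: kernel_op_def scaleR_diff_right)

lemma kernel_op_diff_left:
  assumes "kernel_converges k f t" "kernel_converges l f t"
  shows "kernel_op (\<lambda>u. k u - l u) f t = kernel_op k f t - kernel_op l f t"
  using set_integral_diff(2)[OF assms[unfolded kernel_converges_def]]
  by (simp add: kernel_op_def scaleR_diff_left)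

lemma nn_integral_scaled:
  fixes \<phi> :: "real \<Rightarrow> ennreal"
  assumes [measurable]: "w \<in> borel_measurable borel" "\<phi> \<in> borel_measurable borel"
    and w: "\<And>u. 0 \<le> w u"
  shows "(\<integral>\<^sup>+t. \<integral>\<^sup>+u. ennreal (w u) * indicator {0<..} u * \<phi> (t * u) \<partial>lborel \<partial>lborel)
    = (\<integral>\<^sup>+u. ennreal (w u / u) * indicator {0<..} u \<partial>lborel) * (\<integral>\<^sup>+x. \<phi> x \<partial>lborel)"
proof -
  have "(\<integral>\<^sup>+t. \<integral>\<^sup>+u. ennreal (w u) * indicator {0<..} u * \<phi> (t * u) \<partial>lborel \<partial>lborel)
      = (\<integral>\<^sup>+u. \<integral>\<^sup>+t. ennreal (w u) * indicator {0<..} u * \<phi> (t * u) \<partial>lborel \<partial>lborel)"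
    by (rule lborel_pair.Fubini') measurable
  also have "\<dots> = (\<integral>\<^sup>+u. ennreal (w u / u) * indicator {0<..} u * (\<integral>\<^sup>+x. \<phi> x \<partial>lborel) \<partial>lborel)"
  proof (intro nn_integral_cong)
    fix u :: real
    show "(\<integral>\<^sup>+t. ennreal (w u) * indicator {0<..} u * \<phi> (t * u) \<partial>lborel)
        = ennreal (w u / u) * indicator {0<..} u * (\<integral>\<^sup>+x. \<phi> x \<partial>lborel)"
    proof (cases "0 < u")
      case True
      have "(\<integral>\<^sup>+x. \<phi> x \<partial>lborel) = ennreal u * (\<integral>\<^sup>+t. \<phi> (t * u) \<partial>lborel)"
        using nn_integral_real_affine[of \<phi> u 0] True by (simp add: mult.commute)
      moreover have "ennreal (w u / u) * ennreal u = ennreal (w u)"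
        using True w by (simp flip: ennreal_mult)
      ultimately show ?thesis
        using True by (simp add: nn_integral_cmult flip: mult.assoc)
    qed simp
  qed
  also have "\<dots> = (\<integral>\<^sup>+u. ennreal (w u / u) * indicator {0<..} u \<partial>lborel) * (\<integral>\<^sup>+x. \<phi> x \<partial>lborel)"
    by (rule nn_integral_multc) measurable
  finally show ?thesis .
qed

text \<open>If \<open>a\<close> exceeds \<open>c * b\<close>, write
  \<open>a = a powr (1 - p) * a powr p\<close>: the exponent \<open>1 - p\<close> is nonpositive, so
  replacing \<open>a\<close> by the smaller \<open>c * b\<close> in the first factor can only
  increase it. With \<open>b = u powr (- 1 / p)\<close> the first term integrates to the moment and
  the second to a weighted p-th power of \<open>f\<close>.\<close>

lemma le_scale_plus_powr:
  fixes a b c p :: real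
  assumes "0 \<le> a" "0 < b" "0 < c" "1 \<le> p"
  shows "a \<le> c * b + c powr (1 - p) * (b powr (1 - p) * a powr p)"
proof (cases "a \<le> c * b")
  case True
  then show ?thesis by (simp add: add_increasing2)
next
  case False
  then have a: "0 < a" using assms by (smt (verit) mult_pos_pos)
  have "a = a powr (1 - p) * a powr p"
    using a by (simp flip: powr_add)
  also have "\<dots> \<le> (c * b) powr (1 - p) * a powr p"
    using False assms by (intro mult_right_mono powr_mono2') auto
  also have "\<dots> = c powr (1 - p) * (b powr (1 - p) * a powr p)"
    using assms by (simp add: powr_mult)
  finally show ?thesis
    using assms by (smt (verit) mult_pos_pos)
qed

lemma powr_le_if_le_all_scales:
  fixes s K x p :: real
  assumes le: "\<And>c. 0 < c \<Longrightarrow> s \<le> c * K + c powr (1 - p) * x"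
    and "0 \<le> s" "0 < K" "0 \<le> x" "1 \<le> p"
  shows "s powr p \<le> 2 powr p * K powr (p - 1) * x"
proof (cases "x = 0")
  case True
  have "s = 0"
  proof (rule ccontr)
    assume "s \<noteq> 0"
    then show False
      using le[of "s / (2 * K)"] True assms by (auto simp: field_simps)
  qed
  then show ?thesis using assms by simp
next
  case False
  \<comment> \<open>This choice balances the two terms: \<open>c powr p = x / K\<close> makes
    \<open>c powr (1 - p) * x\<close> equal to \<open>c * K\<close>. For \<open>x = 0\<close> it
    would degenerate to \<open>c = 0\<close>, hence the separate case.\<close>
  define c where "c = (x / K) powr (1 / p)"
  have c: "0 < c" using False assms by (simp add: c_def)
  have cp: "c powr p = x / K"
    using False assms by (simp add: c_def powr_powr)
  have "c powr (1 - p) * x = c * K"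
    using c assms False by (simp add: powr_diff cp)
  then have "s \<le> 2 * c * K"
    using le[OF c] by (simp add: mult_ac)
  then have "s powr p \<le> (2 * c * K) powr p"
    using assms by (intro powr_mono2) auto
  also have "\<dots> = 2 powr p * (x / K) * K powr p"
    using c assms by (simp add: powr_mult cp)
  also have "\<dots> = 2 powr p * K powr (p - 1) * x"
    using assms by (simp add: powr_diff)
  finally show ?thesis .
qed

text \<open>
  Splitting at every scale \<open>c\<close> and optimising over \<open>c\<close> replaces Minkowski's integral inequality.
  The price is the constant \<open>2 powr p\<close>; the power of \<open>K\<close> is the right one.
\<close>

lemma kernel_op_pointwise:
  assumes [measurable]: "k \<in> borel_measurable borel" "f \<in> borel_measurable borel"
    and k: "\<And>u. 0 \<le> k u" and p: "1 \<le> p" and K: "0 < K" "kernel_moment p k \<le> ennreal K"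
  defines "X \<equiv> \<lambda>t. \<integral>\<^sup>+u. ennreal (k u * u powr (1 - 1 / p)) * indicator {0<..} u * ennreal (norm (f (t * u)) powr p) \<partial>lborel"
  shows "X t < \<infinity> \<Longrightarrow> kernel_converges k f t"
    and "ennreal (norm (kernel_op k f t) powr p) \<le> ennreal (2 powr p * K powr (p - 1)) * X t"
proof -
  let ?h = "\<lambda>u. indicator {0<..} u *\<^sub>R (k u *\<^sub>R f (t * u))"
  let ?J = "\<integral>\<^sup>+u. ennreal (norm (?h u)) \<partial>lborel"
  have J: "?J \<le> ennreal (c * K) + ennreal (c powr (1 - p)) * X t" if c: "0 < c" for c
  proof -
    have "?J \<le> (\<integral>\<^sup>+u. ennreal c * (ennreal (k u * u powr (- 1 / p)) * indicator {0<..} u)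
        + ennreal (c powr (1 - p)) * (ennreal (k u * u powr (1 - 1 / p)) * indicator {0<..} u * ennreal (norm (f (t * u)) powr p)) \<partial>lborel)"
    proof (intro nn_integral_mono)
      fix u :: real
      show "ennreal (norm (?h u)) \<le> ennreal c * (ennreal (k u * u powr (- 1 / p)) * indicator {0<..} u)
        + ennreal (c powr (1 - p)) * (ennreal (k u * u powr (1 - 1 / p)) * indicator {0<..} u * ennreal (norm (f (t * u)) powr p))"
      proof (cases "0 < u")
        case True
        let ?a = "norm (f (t * u))"
        have eq: "(u powr (- 1 / p)) powr (1 - p) = u powr (1 - 1 / p)"
          using p by (simp add: powr_powr diff_divide_distrib)
        have "?a \<le> c * u powr (- 1 / p) + c powr (1 - p) * (u powr (1 - 1 / p) * ?a powr p)"
          using le_scale_plus_powr[of ?a "u powr (- 1 / p)" c p] True c p unfolding eq by simp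
        then have "k u * ?a \<le> k u * (c * u powr (- 1 / p) + c powr (1 - p) * (u powr (1 - 1 / p) * ?a powr p))"
          by (rule mult_left_mono) (rule k)
        also have "\<dots> = c * (k u * u powr (- 1 / p)) + c powr (1 - p) * (k u * u powr (1 - 1 / p) * ?a powr p)"
          by (simp add: algebra_simps)
        finally have "ennreal (k u * ?a) \<le> ennreal \<dots>"
          by (rule ennreal_leI)
        then show ?thesis
          using True k c by (simp add: ennreal_mult)
      qed simp
    qed
    also have "\<dots> = ennreal c * kernel_moment p k + ennreal (c powr (1 - p)) * X t"
      unfolding kernel_moment_def X_def by (simp add: nn_integral_add nn_integral_cmult)
    also have "\<dots> \<le> ennreal c * ennreal K + ennreal (c powr (1 - p)) * X t"
      by (intro add_right_mono mult_left_mono K) simp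
    finally show ?thesis
      using c K by (simp add: ennreal_mult)
  qed
  show "kernel_converges k f t" if "X t < \<infinity>"
    unfolding kernel_converges_def set_integrable_def
  proof (rule integrableI_bounded)
    show "?J < \<infinity>"
      using J[of 1] that by (auto intro: order_le_less_trans)
  qed measurable
  show "ennreal (norm (kernel_op k f t) powr p) \<le> ennreal (2 powr p * K powr (p - 1)) * X t"
  proof (cases "X t")
    case (real x)
    have "norm (kernel_op k f t) \<le> c * K + c powr (1 - p) * x" if c: "0 < c" for c
    proof -
      have "ennreal (norm (kernel_op k f t)) \<le> ?J"
        unfolding kernel_op_def set_lebesgue_integral_def by (rule ennreal_norm_integral_le)
      also have "\<dots> \<le> ennreal (c * K + c powr (1 - p) * x)"
        using J[OF c] real c K by (simp add: ennreal_mult)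
      finally show ?thesis
        using c K real by (subst (asm) ennreal_le_iff) auto
    qed
    then have "norm (kernel_op k f t) powr p \<le> 2 powr p * K powr (p - 1) * x"
      using K p real by (intro powr_le_if_le_all_scales) auto
    then show ?thesis
      using real by (simp add: ennreal_leI flip: ennreal_mult)
  next
    case top
    then show ?thesis using K by (simp add: ennreal_mult_top)
  qed
qed

text \<open>The weight in the pointwise bound is one power of \<open>u\<close> above the moment; the
  division by \<open>u\<close> in \<open>nn_integral_scaled\<close> restores the moment and
  contributes the remaining factor \<open>K\<close>. Finiteness of the integral of \<open>X\<close>
  makes \<open>X t\<close> finite, and so the defining integral convergent, for almost every
  \<open>t\<close>.\<close>

lemma kernel_op_bounded:
  assumes [measurable]: "k \<in> borel_measurable borel" "f \<in> borel_measurable borel"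
    and k: "\<And>u. 0 \<le> k u" and p: "1 \<le> p" and K: "0 < K" "kernel_moment p k \<le> ennreal K"
  shows "power_integral p (kernel_op k f) \<le> ennreal (2 powr p * K powr p) * power_integral p f"
    and "power_integral p f < \<infinity> \<Longrightarrow> AE t in lborel. kernel_converges k f t"
proof -
  define X where "X = (\<lambda>t. \<integral>\<^sup>+u. ennreal (k u * u powr (1 - 1 / p)) * indicator {0<..} u * ennreal (norm (f (t * u)) powr p) \<partial>lborel)"
  have X[measurable]: "X \<in> borel_measurable borel" unfolding X_def by measurable
  have "(\<integral>\<^sup>+t. X t \<partial>lborel) = (\<integral>\<^sup>+u. ennreal (k u * u powr (1 - 1 / p) / u) * indicator {0<..} u \<partial>lborel) * power_integral p f"
    unfolding X_def power_integral_def by (rule nn_integral_scaled) (use k in auto)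
  also have "(\<integral>\<^sup>+u. ennreal (k u * u powr (1 - 1 / p) / u) * indicator {0<..} u \<partial>lborel) = kernel_moment p k"
    unfolding kernel_moment_def
    by (intro nn_integral_cong) (auto simp: indicator_def powr_diff powr_minus_divide)
  finally have IX: "(\<integral>\<^sup>+t. X t \<partial>lborel) \<le> ennreal K * power_integral p f"
    using K by (simp add: mult_right_mono)
  have "power_integral p (kernel_op k f) \<le> (\<integral>\<^sup>+t. ennreal (2 powr p * K powr (p - 1)) * X t \<partial>lborel)"
    unfolding power_integral_def X_def
    by (intro nn_integral_mono kernel_op_pointwise(2)) (use k p K in auto)
  also have "\<dots> = ennreal (2 powr p * K powr (p - 1)) * (\<integral>\<^sup>+t. X t \<partial>lborel)"
    by (rule nn_integral_cmult) measurable
  also have "\<dots> \<le> ennreal (2 powr p * K powr (p - 1)) * (ennreal K * power_integral p f)"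
    by (intro mult_left_mono IX) simp
  also have "\<dots> = ennreal (2 powr p * K powr (p - 1) * K) * power_integral p f"
    using K by (simp add: ennreal_mult mult.assoc)
  also have "2 powr p * K powr (p - 1) * K = 2 powr p * K powr p"
    using K by (simp add: powr_diff)
  finally show "power_integral p (kernel_op k f) \<le> ennreal (2 powr p * K powr p) * power_integral p f" .
  assume "power_integral p f < \<infinity>"
  then have "(\<integral>\<^sup>+t. X t \<partial>lborel) < \<infinity>"
    using IX by (auto intro: order_le_less_trans simp: ennreal_mult_less_top)
  then have "AE t in lborel. X t \<noteq> \<infinity>"
    by (intro nn_integral_PInf_AE) auto
  then show "AE t in lborel. kernel_converges k f t"
  proof eventually_elim
    case (elim t)
    then show ?case
      unfolding X_def by (intro kernel_op_pointwise(1)) (use k p K in \<open>auto simp: less_top\<close>)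
  qed
qed

lemma kernel_moment_cases:
  assumes "kernel_moment p k < \<infinity>"
  obtains K where "0 < K" "kernel_moment p k \<le> ennreal K"
proof
  show "0 < enn2real (kernel_moment p k) + 1" by (simp add: add_nonneg_pos)
  show "kernel_moment p k \<le> ennreal (enn2real (kernel_moment p k) + 1)"
    using assms by (simp add: ennreal_plus del: ennreal_1)
qed

lemma kernel_op_power_integral_finite:
  assumes "k \<in> borel_measurable borel" "f \<in> borel_measurable borel"
    and "\<And>u. 0 \<le> k u" and "1 \<le> p" and "kernel_moment p k < \<infinity>" and "power_integral p f < \<infinity>"
  shows "power_integral p (kernel_op k f) < \<infinity>" "AE t in lborel. kernel_converges k f t"
proof -
  obtain K where K: "0 < K" "kernel_moment p k \<le> ennreal K"
    using kernel_moment_cases[OF assms(5)] .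
  note * = kernel_op_bounded[OF assms(1-4) K]
  show "power_integral p (kernel_op k f) < \<infinity>"
    using *(1) assms(6) by (auto intro: order_le_less_trans simp: ennreal_mult_less_top)
  show "AE t in lborel. kernel_converges k f t"
    using *(2) assms(6) .
qed

text \<open>The lower cut makes the 1-moment finite (\<open>kernel_moment_truncate_finite\<close>);
  the matching upper cut ensures that the reciprocal kernel is truncated to the same interval
  (\<open>truncate_kernel_reciprocal\<close>).\<close>

definition truncate_kernel :: "nat \<Rightarrow> (real \<Rightarrow> real) \<Rightarrow> real \<Rightarrow> real" where
  "truncate_kernel n k u = (if 1 / real (Suc n) < u \<and> u < real (Suc n) then k u else 0)"

lemma borel_measurable_truncate_kernel [measurable]:
  assumes [measurable]: "k \<in> borel_measurable borel"
  shows "truncate_kernel n k \<in> borel_measurable borel"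
  unfolding truncate_kernel_def[abs_def] by measurable

lemma kernel_moment_mono:
  assumes "\<And>u. 0 < u \<Longrightarrow> k u \<le> l u"
  shows "kernel_moment p k \<le> kernel_moment p l"
  unfolding kernel_moment_def using assms
  by (intro nn_integral_mono) (auto simp: indicator_def intro!: ennreal_leI mult_right_mono)

lemma kernel_moment_truncate_tendsto:
  assumes [measurable]: "k \<in> borel_measurable borel" and k: "\<And>u. 0 \<le> k u"
    and fin: "kernel_moment p k < \<infinity>"
  shows "(\<lambda>n. kernel_moment p (\<lambda>u. k u - truncate_kernel n k u)) \<longlonglongrightarrow> 0"
proof -
  let ?v = "\<lambda>n u. ennreal ((k u - truncate_kernel n k u) * u powr (- 1 / p)) * indicator {0<..} u"
  have "(\<lambda>n. \<integral>\<^sup>+u. ?v n u \<partial>lborel) \<longlonglongrightarrow> (\<integral>\<^sup>+u. 0 \<partial>(lborel :: real measure))"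
  proof (rule nn_integral_dominated_convergence)
    show "AE u in lborel. ?v n u \<le> ennreal (k u * u powr (- 1 / p)) * indicator {0<..} u" for n
      using k by (intro AE_I2) (auto simp: truncate_kernel_def indicator_def intro!: ennreal_leI mult_right_mono)
    show "(\<integral>\<^sup>+u. ennreal (k u * u powr (- 1 / p)) * indicator {0<..} u \<partial>lborel) < \<infinity>"
      using fin unfolding kernel_moment_def .
    show "AE u in lborel. (\<lambda>n. ?v n u) \<longlonglongrightarrow> 0"
    proof (intro AE_I2)
      fix u :: real
      show "(\<lambda>n. ?v n u) \<longlonglongrightarrow> 0"
      proof (cases "0 < u")
        case True
        obtain N where N: "max u (1 / u) < real N" using reals_Archimedean2 by blast
        have "?v n u = 0" if "N \<le> n" for n
        proof -
          have "u < Suc n" "1 / u < Suc n" using N that by auto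
          then have "u < Suc n" "1 / Suc n < u" using True by (auto simp: field_simps)
          then show ?thesis by (simp add: truncate_kernel_def)
        qed
        then show ?thesis
          by (intro tendsto_eventually eventually_sequentiallyI)
      qed simp
    qed
  qed measurable
  then show ?thesis by (simp add: kernel_moment_def)
qed

text \<open>Kernel and function vary together, so the difference is split at
  \<open>kernel_op (truncate_kernel n k) f\<close>. The first part is small because all truncations
  share the moment bound \<open>K\<close>, the second because the moment of the removed part of the
  kernel tends to 0.\<close>

lemma kernel_op_truncate_tendsto:
  assumes k[measurable]: "k \<in> borel_measurable borel" and k0: "\<And>u. 0 \<le> k u"
    and p: "1 \<le> p" and fin: "kernel_moment p k < \<infinity>"
    and F[measurable]: "\<And>n. F n \<in> borel_measurable borel" and f[measurable]: "f \<in> borel_measurable borel"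
    and Ffin: "\<And>n. power_integral p (F n) < \<infinity>" and ffin: "power_integral p f < \<infinity>"
    and lim: "(\<lambda>n. power_integral p (\<lambda>x. F n x - f x)) \<longlonglongrightarrow> 0"
  shows "(\<lambda>n. power_integral p (\<lambda>x. kernel_op (truncate_kernel n k) (F n) x - kernel_op k f x)) \<longlonglongrightarrow> 0"
proof (rule power_integral_triangle_tendsto)
  obtain K where K: "0 < K" "kernel_moment p k \<le> ennreal K"
    using kernel_moment_cases[OF fin] .
  have t0: "0 \<le> truncate_kernel n k u" "truncate_kernel n k u \<le> k u" for n u
    using k0 by (auto simp: truncate_kernel_def)
  have Kt: "kernel_moment p (truncate_kernel n k) \<le> ennreal K" for n
    using kernel_moment_mono[of "truncate_kernel n k" k p] t0 K by (meson order_trans)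
  show "(\<lambda>n. power_integral p (\<lambda>x. kernel_op (truncate_kernel n k) (F n) x - kernel_op (truncate_kernel n k) f x)) \<longlonglongrightarrow> 0"
  proof (rule tendsto_sandwich[OF _ _ tendsto_const])
    show "(\<lambda>n. ennreal (2 powr p * K powr p) * power_integral p (\<lambda>x. F n x - f x)) \<longlonglongrightarrow> 0"
      using ennreal_tendsto_cmult[OF _ lim, of "ennreal (2 powr p * K powr p)"] by simp
    have "power_integral p (\<lambda>x. kernel_op (truncate_kernel n k) (F n) x - kernel_op (truncate_kernel n k) f x)
        \<le> ennreal (2 powr p * K powr p) * power_integral p (\<lambda>x. F n x - f x)" for n
    proof -
      have c: "AE t in lborel. kernel_converges (truncate_kernel n k) (F n) t"
        "AE t in lborel. kernel_converges (truncate_kernel n k) f t"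
        by (intro kernel_op_bounded(2)[OF _ _ _ p K(1) Kt] t0 Ffin ffin; measurable)+
      have "power_integral p (\<lambda>x. kernel_op (truncate_kernel n k) (F n) x - kernel_op (truncate_kernel n k) f x)
          = power_integral p (kernel_op (truncate_kernel n k) (\<lambda>x. F n x - f x))"
        using c by (intro power_integral_cong_AE, eventually_elim) (simp add: kernel_op_diff)
      also have "\<dots> \<le> ennreal (2 powr p * K powr p) * power_integral p (\<lambda>x. F n x - f x)"
        by (intro kernel_op_bounded(1)[OF _ _ _ p K(1) Kt] t0; measurable)
      finally show ?thesis .
    qed
    then show "\<forall>\<^sub>F n in sequentially. power_integral p (\<lambda>x. kernel_op (truncate_kernel n k) (F n) x - kernel_op (truncate_kernel n k) f x)
        \<le> ennreal (2 powr p * K powr p) * power_integral p (\<lambda>x. F n x - f x)"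
      by (intro always_eventually allI)
  qed auto
  let ?r = "\<lambda>n u. k u - truncate_kernel n k u"
  \<comment> \<open>\<open>kernel_op_bounded\<close> wants a strictly positive bound, but the moment
    of the removed part may be 0; the summand \<open>inverse (Suc n)\<close> secures positivity
    without spoiling the limit.\<close>
  let ?K = "\<lambda>n. enn2real (kernel_moment p (?r n)) + inverse (Suc n)"
  have rm: "kernel_moment p (?r n) < \<infinity>" for n
    using kernel_moment_mono[of "?r n" k p] t0 fin by (auto intro: order_le_less_trans)
  show "(\<lambda>n. power_integral p (\<lambda>x. kernel_op (truncate_kernel n k) f x - kernel_op k f x)) \<longlonglongrightarrow> 0"
  proof (rule tendsto_sandwich[OF _ _ tendsto_const])
    have "(\<lambda>n. enn2real (kernel_moment p (?r n))) \<longlonglongrightarrow> 0"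
      using kernel_moment_truncate_tendsto[OF k k0 fin] by (intro tendsto_enn2real) simp_all
    then have "?K \<longlonglongrightarrow> 0 + 0"
      using LIMSEQ_inverse_real_of_nat by (intro tendsto_add) auto
    then have "(\<lambda>n. 2 powr p * ?K n powr p) \<longlonglongrightarrow> 2 powr p * 0 powr p"
      using p by (intro tendsto_intros tendsto_powr') auto
    then have "(\<lambda>n. ennreal (2 powr p * ?K n powr p)) \<longlonglongrightarrow> ennreal 0"
      by (intro tendsto_ennrealI) simp
    from ennreal_tendsto_cmult[OF ffin[unfolded infinity_ennreal_def] this]
    show "(\<lambda>n. ennreal (2 powr p * ?K n powr p) * power_integral p f) \<longlonglongrightarrow> 0"
      by (simp add: mult.commute)
    have "power_integral p (\<lambda>x. kernel_op (truncate_kernel n k) f x - kernel_op k f x)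
        \<le> ennreal (2 powr p * ?K n powr p) * power_integral p f" for n
    proof -
      have c: "AE t in lborel. kernel_converges (truncate_kernel n k) f t"
        by (intro kernel_op_bounded(2)[OF _ _ _ p K(1) Kt] t0 ffin; measurable)
      have c': "AE t in lborel. kernel_converges k f t"
        by (intro kernel_op_bounded(2)[OF _ _ k0 p K] ffin; measurable)
      have "power_integral p (\<lambda>x. kernel_op (truncate_kernel n k) f x - kernel_op k f x)
          = power_integral p (\<lambda>x. kernel_op k f x - kernel_op (truncate_kernel n k) f x)"
        by (rule power_integral_diff_commute)
      also have "\<dots> = power_integral p (kernel_op (?r n) f)"
        using c c' by (intro power_integral_cong_AE, eventually_elim) (simp add: kernel_op_diff_left)
      also have "\<dots> \<le> ennreal (2 powr p * ?K n powr p) * power_integral p f"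
      proof (rule kernel_op_bounded(1))
        show "0 < ?K n" by (simp add: add_nonneg_pos)
        show "kernel_moment p (?r n) \<le> ennreal (?K n)"
          using rm[of n] by (simp add: ennreal_plus)
      qed (use t0 p in auto)
      finally show ?thesis .
    qed
    then show "\<forall>\<^sub>F n in sequentially. power_integral p (\<lambda>x. kernel_op (truncate_kernel n k) f x - kernel_op k f x)
        \<le> ennreal (2 powr p * ?K n powr p) * power_integral p f"
      by (intro always_eventually allI)
  qed auto
qed (use p in \<open>auto intro!: measurable_completion\<close>)

subsection \<open>Stieltjes kernels under the Fourier transform\<close>

text \<open>The change-of-variables theorem applied here speaks of \<open>lebesgue\<close> and the
  gauge integral, which explains the detour from \<open>lborel\<close> and back.\<close>

lemma set_integral_reciprocal:
  fixes \<phi> :: "real \<Rightarrow> complex"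
  assumes [measurable]: "\<phi> \<in> borel_measurable borel"
    and int: "set_integrable lborel {0<..} \<phi>"
  shows "(LINT u:{0<..}|lborel. \<phi> u) = (LINT v:{0<..}|lborel. (1 / v\<^sup>2) *\<^sub>R \<phi> (1 / v))"
proof -
  have leb: "set_integrable lebesgue {0<..} \<phi>"
    using int unfolding set_integrable_def by (subst integrable_completion) auto
  have img: "(\<lambda>v::real. 1 / v) ` {0<..} = {0<..}"
    by (auto simp: image_iff intro!: bexI[of _ "1 / _"])
  have "(\<lambda>v. \<bar>- (1 / v\<^sup>2)\<bar> *\<^sub>R \<phi> (1 / v)) absolutely_integrable_on {0<..} \<and>
      integral {0<..} (\<lambda>v. \<bar>- (1 / v\<^sup>2)\<bar> *\<^sub>R \<phi> (1 / v)) = integral {0<..} \<phi> \<longleftrightarrow>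
      \<phi> absolutely_integrable_on (\<lambda>v. 1 / v) ` {0<..} \<and> integral ((\<lambda>v. 1 / v) ` {0<..}) \<phi> = integral {0<..} \<phi>"
  proof (rule has_absolute_integral_change_of_variables_real)
    show "((\<lambda>v. 1 / v) has_real_derivative - (1 / x\<^sup>2)) (at x within {0<..})" if "x \<in> {0<..}" for x
      using that by (auto intro!: derivative_eq_intros simp: power2_eq_square)
  qed (auto simp: inj_on_def)
  then have *: "set_integrable lebesgue {0<..} (\<lambda>v. (1 / v\<^sup>2) *\<^sub>R \<phi> (1 / v))"
    "integral {0<..} (\<lambda>v. (1 / v\<^sup>2) *\<^sub>R \<phi> (1 / v)) = integral {0<..} \<phi>"
    using leb unfolding img by auto
  have "set_integrable lborel {0<..} (\<lambda>v. (1 / v\<^sup>2) *\<^sub>R \<phi> (1 / v))"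
    using *(1) unfolding set_integrable_def by (subst (asm) integrable_completion) auto
  then show ?thesis
    using *(2) int by (simp add: set_borel_integral_eq_integral(2))
qed

lemma integral_fourier_scaled:
  assumes [measurable]: "f \<in> borel_measurable borel" and u: "0 < u"
  shows "(LINT t|lborel. exp (- \<i> * of_real (t * x)) * f (t * u)) = (1 / u) *\<^sub>R fourier_L1 f (x / u)"
proof -
  have "fourier_L1 f (x / u) = u *\<^sub>R (LINT t|lborel. exp (- \<i> * of_real ((0 + u * t) * (x / u))) * f (0 + u * t))"
    unfolding fourier_L1_borel[OF assms(1)]
    using u by (subst lborel_integral_real_affine[where c = u and t = 0]) auto
  also have "(LINT t|lborel. exp (- \<i> * of_real ((0 + u * t) * (x / u))) * f (0 + u * t))
      = (LINT t|lborel. exp (- \<i> * of_real (t * x)) * f (t * u))"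
    using u by (intro Bochner_Integration.integral_cong) (auto simp: mult.commute)
  finally show ?thesis using u by simp
qed

lemma kernel_op_fourier_L1:
  assumes k[measurable]: "k \<in> borel_measurable borel" and k0: "\<And>u. 0 \<le> k u"
    and fin: "kernel_moment 1 k < \<infinity>" and f: "integrable lborel f"
  shows "integrable lborel (kernel_op k f)"
    and "fourier_L1 (kernel_op k f) x = kernel_op (\<lambda>v. k (1 / v) / v) (fourier_L1 f) x"
proof -
  have fm[measurable]: "f \<in> borel_measurable borel" using f by simp
  have f1: "power_integral 1 f < \<infinity>"
    using f by (simp add: power_integral_def integrable_iff_bounded)
  show int: "integrable lborel (kernel_op k f)"
  proof (rule integrableI_bounded)
    show "(\<integral>\<^sup>+t. ennreal (norm (kernel_op k f t)) \<partial>lborel) < \<infinity>"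
      using kernel_op_power_integral_finite(1)[OF k fm k0 _ fin f1] by (simp add: power_integral_def)
  qed measurable
  let ?h = "\<lambda>t u. exp (- \<i> * of_real (t * x)) * (indicator {0<..} u *\<^sub>R (k u *\<^sub>R f (t * u)))"
  have h_int: "integrable (lborel \<Otimes>\<^sub>M lborel) (\<lambda>(t, u). ?h t u)"
  proof (rule integrableI_bounded)
    have "(\<integral>\<^sup>+z. ennreal (norm (case z of (t, u) \<Rightarrow> ?h t u)) \<partial>(lborel \<Otimes>\<^sub>M lborel))
        = (\<integral>\<^sup>+t. \<integral>\<^sup>+u. ennreal (norm (?h t u)) \<partial>lborel \<partial>lborel)"
      by (subst lborel.nn_integral_fst[symmetric]) (auto simp: split_beta')
    also have "\<dots> = (\<integral>\<^sup>+t. \<integral>\<^sup>+u. ennreal (k u) * indicator {0<..} u * ennreal (norm (f (t * u))) \<partial>lborel \<partial>lborel)"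
    proof (intro nn_integral_cong)
      fix t u :: real
      show "ennreal (norm (?h t u)) = ennreal (k u) * indicator {0<..} u * ennreal (norm (f (t * u)))"
        using k0[of u] by (simp add: norm_mult indicator_def ennreal_mult)
    qed
    also have "\<dots> = (\<integral>\<^sup>+u. ennreal (k u / u) * indicator {0<..} u \<partial>lborel) * (\<integral>\<^sup>+x. ennreal (norm (f x)) \<partial>lborel)"
      by (rule nn_integral_scaled) (use k0 in auto)
    also have "(\<integral>\<^sup>+u. ennreal (k u / u) * indicator {0<..} u \<partial>lborel) = kernel_moment 1 k"
      unfolding kernel_moment_def
      by (intro nn_integral_cong) (auto simp: indicator_def powr_minus_divide)
    also have "kernel_moment 1 k * (\<integral>\<^sup>+x. ennreal (norm (f x)) \<partial>lborel) < \<infinity>"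
      using fin f by (simp add: integrable_iff_bounded ennreal_mult_less_top)
    finally show "(\<integral>\<^sup>+z. ennreal (norm (case z of (t, u) \<Rightarrow> ?h t u)) \<partial>(lborel \<Otimes>\<^sub>M lborel)) < \<infinity>" .
  qed measurable
  \<comment> \<open>The result of the inner integration in \<open>t\<close> at fixed
    \<open>u\<close>. It is integrable over the half line because the transform of \<open>f\<close>
    is bounded and the 1-moment of \<open>k\<close> is finite.\<close>
  define \<phi> where "\<phi> = (\<lambda>u. (k u / u) *\<^sub>R fourier_L1 f (x / u))"
  have [measurable]: "\<phi> \<in> borel_measurable borel" unfolding \<phi>_def by measurable
  have "fourier_L1 (kernel_op k f) x = (LINT t|lborel. (LINT u|lborel. ?h t u))"
    by (simp only: fourier_L1_borel[OF borel_measurable_kernel_op[OF k fm]] kernel_op_def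
        set_lebesgue_integral_def integral_mult_right_zero)
  also have "\<dots> = (LINT u|lborel. (LINT t|lborel. ?h t u))"
    by (rule lborel_pair.Fubini_integral[symmetric]) (rule h_int)
  also have "\<dots> = (LINT u:{0<..}|lborel. \<phi> u)"
    unfolding set_lebesgue_integral_def
  proof (intro Bochner_Integration.integral_cong refl)
    fix u :: real
    show "(LINT t|lborel. ?h t u) = indicator {0<..} u *\<^sub>R \<phi> u"
    proof (cases "0 < u")
      case True
      then have "(LINT t|lborel. ?h t u) = (LINT t|lborel. k u *\<^sub>R (exp (- \<i> * of_real (t * x)) * f (t * u)))"
        by (intro Bochner_Integration.integral_cong refl) simp
      also have "\<dots> = k u *\<^sub>R (LINT t|lborel. exp (- \<i> * of_real (t * x)) * f (t * u))"
        by (rule integral_scaleR_right)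
      also have "\<dots> = \<phi> u"
        unfolding integral_fourier_scaled[OF fm True] by (simp add: \<phi>_def)
      finally show ?thesis using True by simp
    qed simp
  qed
  also have "\<dots> = (LINT v:{0<..}|lborel. (1 / v\<^sup>2) *\<^sub>R \<phi> (1 / v))"
  proof (rule set_integral_reciprocal)
    show "set_integrable lborel {0<..} \<phi>"
      unfolding set_integrable_def
    proof (rule integrableI_bounded)
      let ?M = "LINT x|lborel. norm (f x)"
      have "(\<integral>\<^sup>+u. ennreal (norm (indicator {0<..} u *\<^sub>R \<phi> u)) \<partial>lborel)
          \<le> (\<integral>\<^sup>+u. ennreal ?M * (ennreal (k u * u powr (- 1 / 1)) * indicator {0<..} u) \<partial>lborel)"
      proof (intro nn_integral_mono)
        fix u :: real
        show "ennreal (norm (indicator {0<..} u *\<^sub>R \<phi> u))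
            \<le> ennreal ?M * (ennreal (k u * u powr (- 1 / 1)) * indicator {0<..} u)"
        proof (cases "0 < u")
          case True
          have "norm (\<phi> u) \<le> ?M * (k u / u)"
            unfolding \<phi>_def using True k0[of u]
            by (simp add: mult.commute divide_right_mono mult_left_mono norm_fourier_L1_le[OF f])
          then show ?thesis
            using True k0[of u] by (simp add: powr_minus_divide ennreal_leI flip: ennreal_mult)
        qed simp
      qed
      also have "\<dots> = ennreal ?M * kernel_moment 1 k"
        unfolding kernel_moment_def by (rule nn_integral_cmult) measurable
      also have "\<dots> < \<infinity>" using fin by (simp add: ennreal_mult_less_top)
      finally show "(\<integral>\<^sup>+u. ennreal (norm (indicator {0<..} u *\<^sub>R \<phi> u)) \<partial>lborel) < \<infinity>" .
    qed measurable
  qed measurable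
  also have "\<dots> = kernel_op (\<lambda>v. k (1 / v) / v) (fourier_L1 f) x"
    unfolding kernel_op_def
    by (intro set_lebesgue_integral_cong) (auto simp: \<phi>_def power2_eq_square)
  finally show "fourier_L1 (kernel_op k f) x = kernel_op (\<lambda>v. k (1 / v) / v) (fourier_L1 f) x" .
qed

section \<open>Stieltjes kernels: reciprocals, truncation and moments\<close>

lemma kernel_op_cong:
  assumes "\<And>u. 0 < u \<Longrightarrow> k u = l u"
  shows "kernel_op k = kernel_op l"
  unfolding kernel_op_def by (intro ext set_lebesgue_integral_cong) (auto simp: assms)

lemma stieltjes_kernel_nonneg [simp]: "0 \<le> stieltjes_kernel b m u"
  by (simp add: stieltjes_kernel_def)

lemma borel_measurable_stieltjes_kernel [measurable]: "stieltjes_kernel b m \<in> borel_measurable borel"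
  unfolding stieltjes_kernel_def[abs_def] by measurable

lemma stieltjes_kernel_reciprocal:
  assumes "0 < v"
  shows "stieltjes_kernel b m (1 / v) / v = stieltjes_kernel (m - b + 1) m v"
proof -
  have "1 + 1 / v = (1 + v) / v" using assms by (simp add: field_simps)
  then have "stieltjes_kernel b m (1 / v) / v = v powr (1 - b) * v powr m * v powr (- 1) / (1 + v) powr m"
    using assms by (simp add: stieltjes_kernel_def powr_divide powr_minus_divide powr_diff)
  also have "v powr (1 - b) * v powr m * v powr (- 1) = v powr ((1 - b) + m + - 1)"
    by (simp only: powr_add)
  also have "(1 - b) + m + - 1 = m - b + 1 - 1" by simp
  finally show ?thesis by (simp add: stieltjes_kernel_def)
qed

lemma truncate_kernel_reciprocal:
  assumes "0 < v"
  shows "truncate_kernel n (stieltjes_kernel b m) (1 / v) / v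
    = truncate_kernel n (stieltjes_kernel (m - b + 1) m) v"
proof -
  have "1 / real (Suc n) < 1 / v \<longleftrightarrow> v < real (Suc n)" "1 / v < real (Suc n) \<longleftrightarrow> 1 / real (Suc n) < v"
    using assms by (auto simp: field_simps)
  then show ?thesis
    using stieltjes_kernel_reciprocal[OF assms, of b m] by (simp add: truncate_kernel_def)
qed

text \<open>The integrand behaves like \<open>u powr (b - 1 / p - 1)\<close> at 0 and like
  \<open>u powr (b - 1 / p - 1 - m)\<close> at infinity, so the two hypotheses are the conditions
  for convergence at the two ends.\<close>

lemma kernel_moment_stieltjes_finite:
  assumes "0 < b - 1 / p" "b - 1 / p < m"
  shows "kernel_moment p (stieltjes_kernel b m) < \<infinity>"
proof -
  let ?a = "b - 1 / p"
  have m: "0 < m" using assms by simp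
  have "kernel_moment p (stieltjes_kernel b m)
      \<le> (\<integral>\<^sup>+u. ennreal (u powr (?a - 1)) * indicator {0..1} u + ennreal (u powr (?a - 1 - m)) * indicator {1..} u \<partial>lborel)"
    unfolding kernel_moment_def
  proof (intro nn_integral_mono)
    fix u :: real
    show "ennreal (stieltjes_kernel b m u * u powr (- 1 / p)) * indicator {0<..} u
        \<le> ennreal (u powr (?a - 1)) * indicator {0..1} u + ennreal (u powr (?a - 1 - m)) * indicator {1..} u"
    proof (cases "0 < u")
      case True
      have "u powr (b - 1) * u powr (- 1 / p) = u powr (?a - 1)"
        by (simp add: algebra_simps flip: powr_add)
      then have eq: "stieltjes_kernel b m u * u powr (- 1 / p) = u powr (?a - 1) / (1 + u) powr m"
        by (simp add: stieltjes_kernel_def)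
      have "1 \<le> (1 + u) powr m"
        using True m by (intro ge_one_powr_ge_zero) auto
      then have 1: "u powr (?a - 1) / (1 + u) powr m \<le> u powr (?a - 1)"
        using mult_left_mono[of 1 "(1 + u) powr m" "u powr (?a - 1)"] by (simp add: divide_le_eq)
      have "u powr (?a - 1) / (1 + u) powr m \<le> u powr (?a - 1) / u powr m"
        using True m by (intro divide_left_mono powr_mono2) auto
      then have 2: "u powr (?a - 1) / (1 + u) powr m \<le> u powr (?a - 1 - m)"
        by (simp add: powr_diff)
      show ?thesis
      proof (cases "u \<le> 1")
        case le: True
        have "ennreal (u powr (?a - 1) / (1 + u) powr m) \<le> ennreal (u powr (?a - 1))"
          by (rule ennreal_leI) (rule 1)
        then show ?thesis unfolding eq using True le by (simp add: add_increasing2)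
      next
        case False
        have "ennreal (u powr (?a - 1) / (1 + u) powr m) \<le> ennreal (u powr (?a - 1 - m))"
          by (rule ennreal_leI) (rule 2)
        then show ?thesis unfolding eq using True False by simp
      qed
    qed simp
  qed
  also have "\<dots> = (\<integral>\<^sup>+u. ennreal (u powr (?a - 1)) * indicator {0..1} u \<partial>lborel)
      + (\<integral>\<^sup>+u. ennreal (u powr (?a - 1 - m)) * indicator {1..} u \<partial>lborel)"
    by (rule nn_integral_add) measurable
  also have "(\<integral>\<^sup>+u. ennreal (u powr (?a - 1)) * indicator {0..1} u \<partial>lborel) = ennreal (1 powr (?a - 1 + 1) / (?a - 1 + 1))"
    using assms by (intro nn_integral_has_integral_lebesgue' has_integral_powr_from_0) auto
  also have "(\<integral>\<^sup>+u. ennreal (u powr (?a - 1 - m)) * indicator {1..} u \<partial>lborel)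
      = ennreal (- (1 powr (?a - 1 - m + 1)) / (?a - 1 - m + 1))"
    using assms by (intro nn_integral_has_integral_lebesgue' has_integral_powr_to_inf) auto
  finally show ?thesis by (auto intro: order_le_less_trans)
qed

text \<open>On the truncation interval \<open>1 / u < Suc n\<close>, so the factor
  \<open>(1 / u) powr (1 - 1 / p)\<close> separating the two moments is bounded.\<close>

lemma kernel_moment_truncate_finite:
  assumes k[measurable]: "k \<in> borel_measurable borel" and k0: "\<And>u. 0 \<le> k u"
    and p: "1 \<le> p" and fin: "kernel_moment p k < \<infinity>"
  shows "kernel_moment 1 (truncate_kernel n k) < \<infinity>"
proof -
  let ?c = "real (Suc n) powr (1 - 1 / p)"
  have "kernel_moment 1 (truncate_kernel n k)
      \<le> (\<integral>\<^sup>+u. ennreal ?c * (ennreal (k u * u powr (- 1 / p)) * indicator {0<..} u) \<partial>lborel)"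
    unfolding kernel_moment_def
  proof (intro nn_integral_mono)
    fix u :: real
    show "ennreal (truncate_kernel n k u * u powr (- 1 / 1)) * indicator {0<..} u
        \<le> ennreal ?c * (ennreal (k u * u powr (- 1 / p)) * indicator {0<..} u)"
    proof (cases "1 / real (Suc n) < u \<and> u < real (Suc n)")
      case True
      then have u: "0 < u" by (meson less_trans of_nat_0_less_iff zero_less_Suc zero_less_divide_1_iff)
      have "u powr (- 1 / 1) = (1 / u) powr (1 - 1 / p) * u powr (- 1 / p)"
        using u by (simp add: powr_divide powr_diff powr_minus_divide)
      also have "\<dots> \<le> ?c * u powr (- 1 / p)"
        using True u p by (intro mult_right_mono powr_mono2) (auto simp: field_simps)
      finally have "k u * u powr (- 1 / 1) \<le> k u * (?c * u powr (- 1 / p))"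
        by (intro mult_left_mono k0)
      then have "k u * u powr (- 1 / 1) \<le> ?c * (k u * u powr (- 1 / p))"
        by (simp only: mult_ac)
      then have "ennreal (k u * u powr (- 1 / 1)) \<le> ennreal (?c * (k u * u powr (- 1 / p)))"
        by (rule ennreal_leI)
      also have "\<dots> = ennreal ?c * ennreal (k u * u powr (- 1 / p))"
        by (rule ennreal_mult) (use k0 in auto)
      finally show ?thesis using True u by (simp add: truncate_kernel_def)
    qed (auto simp: truncate_kernel_def)
  qed
  also have "\<dots> = ennreal ?c * kernel_moment p k"
    unfolding kernel_moment_def by (rule nn_integral_cmult) measurable
  also have "\<dots> < \<infinity>" using fin by (simp add: ennreal_mult_less_top)
  finally show ?thesis .
qed

section \<open>Passage between Lebesgue and Borel measurable representatives\<close>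

lemma stieltjes_eq_kernel_op:
  assumes [measurable]: "f \<in> borel_measurable borel"
  shows "stieltjes b m f = kernel_op (stieltjes_kernel b m) f"
  unfolding stieltjes_def[abs_def] kernel_op_def[abs_def] set_lebesgue_integral_def
  by (intro ext integral_completion) measurable

lemma stieltjes_converges_eq_kernel_converges:
  assumes [measurable]: "f \<in> borel_measurable borel"
  shows "stieltjes_converges b m f = kernel_converges (stieltjes_kernel b m) f"
  unfolding stieltjes_converges_def[abs_def] kernel_converges_def[abs_def] set_integrable_def
  by (intro ext integrable_completion) measurable

text \<open>For \<open>t \<noteq> 0\<close> dilation by \<open>t\<close> preserves null sets. At
  \<open>t = 0\<close> the integral sees only the value \<open>f 0\<close>, which depends on the
  representative.\<close>

lemma stieltjes_cong_AE:
  assumes f: "f \<in> borel_measurable lebesgue" and g: "g \<in> borel_measurable lebesgue"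
    and eq: "AE x in lebesgue. f x = g x" and t: "t \<noteq> 0"
  shows "stieltjes b m f t = stieltjes b m g t"
    and "stieltjes_converges b m f t \<longleftrightarrow> stieltjes_converges b m g t"
proof -
  have scale: "(\<lambda>u. t * u) \<in> lebesgue \<rightarrow>\<^sub>M lebesgue"
    using lebesgue_measurable_scaling[of t, where 'a = real] by (simp add: real_scaleR_def[abs_def])
  have ind: "(\<lambda>u::real. indicat_real {0<..} u) \<in> borel_measurable lebesgue"
    by (rule measurable_completion) simp
  have ker: "(\<lambda>u. stieltjes_kernel b m u) \<in> borel_measurable lebesgue"
    by (rule measurable_completion) simp
  have meas: "(\<lambda>u. indicat_real {0<..} u *\<^sub>R stieltjes_kernel b m u *\<^sub>R h (t * u)) \<in> borel_measurable lebesgue"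
    if "h \<in> borel_measurable lebesgue" for h :: "real \<Rightarrow> complex"
    by (intro borel_measurable_scaleR ind ker measurable_compose[OF scale that])
  have eq': "AE u in lebesgue. indicator {0<..} u *\<^sub>R stieltjes_kernel b m u *\<^sub>R f (t * u)
      = indicator {0<..} u *\<^sub>R stieltjes_kernel b m u *\<^sub>R g (t * u)"
    using AE_scale[OF eq t] by eventually_elim simp
  show "stieltjes b m f t = stieltjes b m g t"
    unfolding stieltjes_def set_lebesgue_integral_def
    by (intro integral_cong_AE eq' meas f g)
  show "stieltjes_converges b m f t \<longleftrightarrow> stieltjes_converges b m g t"
    unfolding stieltjes_converges_def set_integrable_def
    by (intro integrable_cong_AE eq' meas f g)
qed

subsection \<open>The Fourier transform on \<open>L\<^sup>p\<close>\<close>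

definition cutoff :: "real \<Rightarrow> (real \<Rightarrow> complex) \<Rightarrow> real \<Rightarrow> complex" where
  "cutoff R f = (\<lambda>x. indicator {-R<..<R} x *\<^sub>R f x)"

lemma borel_measurable_cutoff [measurable]:
  assumes [measurable]: "f \<in> borel_measurable borel"
  shows "cutoff R f \<in> borel_measurable borel"
  unfolding cutoff_def by measurable

lemma fourier_eq:
  "fourier p f = (if p = 1 then fourier_L1 f
    else (SOME g. Lp_tendsto (p / (p - 1)) (\<lambda>R. fourier_L1 (cutoff R f)) g at_top))"
  by (simp add: fourier_def cutoff_def)

text \<open>The equality is literal although the limit is determined only up to null sets: the
  cutoffs of \<open>f\<close> and \<open>g\<close> have identical transforms, so the choice operator
  is applied to the same predicate.\<close>

lemma fourier_cong_AE:
  assumes eq: "AE x in lebesgue. f x = g x"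
    and f: "f \<in> borel_measurable lebesgue" and g: "g \<in> borel_measurable lebesgue"
  shows "fourier p f = fourier p g"
proof -
  have "fourier_L1 (cutoff R f) = fourier_L1 (cutoff R g)" for R
  proof (rule fourier_L1_cong_AE)
    show "AE x in lebesgue. cutoff R f x = cutoff R g x"
      using eq by eventually_elim (simp add: cutoff_def)
    have "(\<lambda>x. indicat_real {-R<..<R} x) \<in> borel_measurable lebesgue"
      by (rule measurable_completion) simp
    then show "cutoff R f \<in> borel_measurable lebesgue" "cutoff R g \<in> borel_measurable lebesgue"
      unfolding cutoff_def by (intro borel_measurable_scaleR f g; assumption)+
  qed
  moreover have "fourier_L1 f = fourier_L1 g"
    by (rule fourier_L1_cong_AE[OF eq f g])
  ultimately show ?thesis by (simp add: fourier_eq)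
qed

lemma power_integral_cutoff_le:
  assumes "0 \<le> p"
  shows "power_integral p (cutoff R f) \<le> power_integral p f"
  using assms by (intro power_integral_mono_AE) (auto simp: cutoff_def indicator_def)

text \<open>On a bounded interval the elementary bound
  \<open>norm (f x) \<le> 1 + norm (f x) powr p\<close> does the work of Hoelder's
  inequality.\<close>

lemma integrable_cutoff:
  assumes [measurable]: "f \<in> borel_measurable borel" and p: "1 \<le> p"
    and fin: "power_integral p f < \<infinity>"
  shows "integrable lborel (cutoff R f)"
proof (rule integrableI_bounded)
  have "(\<integral>\<^sup>+x. ennreal (norm (cutoff R f x)) \<partial>lborel)
      \<le> (\<integral>\<^sup>+x. indicator {-R<..<R} x + ennreal (norm (f x) powr p) \<partial>lborel)"
  proof (intro nn_integral_mono)
    fix x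
    have "norm (f x) \<le> 1 + norm (f x) powr p"
    proof (cases "norm (f x) \<le> 1")
      case False
      then have "norm (f x) powr 1 \<le> norm (f x) powr p"
        using p by (intro powr_mono) auto
      then show ?thesis by simp
    qed (simp add: add_increasing2)
    then have "ennreal (norm (f x)) \<le> ennreal (1 + norm (f x) powr p)"
      by (rule ennreal_leI)
    then show "ennreal (norm (cutoff R f x)) \<le> indicator {-R<..<R} x + ennreal (norm (f x) powr p)"
      by (simp add: cutoff_def indicator_def)
  qed
  also have "\<dots> = emeasure lborel {-R<..<R} + power_integral p f"
    unfolding power_integral_def by (subst nn_integral_add) auto
  also have "\<dots> < \<infinity>"
    using fin by (cases "-R \<le> R") auto
  finally show "(\<integral>\<^sup>+x. ennreal (norm (cutoff R f x)) \<partial>lborel) < \<infinity>" .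
qed measurable

lemma power_integral_cutoff_tendsto:
  assumes [measurable]: "f \<in> borel_measurable borel" and p: "0 < p"
    and fin: "power_integral p f < \<infinity>"
  shows "((\<lambda>R. power_integral p (\<lambda>x. cutoff R f x - f x)) \<longlongrightarrow> 0) at_top"
proof -
  have "(\<lambda>n. \<integral>\<^sup>+x. ennreal (norm (cutoff (real n) f x - f x) powr p) \<partial>lborel) \<longlonglongrightarrow> (\<integral>\<^sup>+x. 0 \<partial>(lborel :: real measure))"
  proof (rule nn_integral_dominated_convergence)
    show "(\<integral>\<^sup>+x. ennreal (norm (f x) powr p) \<partial>lborel) < \<infinity>"
      using fin unfolding power_integral_def .
    show "AE x in lborel. ennreal (norm (cutoff (real n) f x - f x) powr p) \<le> ennreal (norm (f x) powr p)" for n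
      by (intro AE_I2) (auto simp: cutoff_def indicator_def)
    show "AE x in lborel. (\<lambda>n. ennreal (norm (cutoff (real n) f x - f x) powr p)) \<longlonglongrightarrow> 0"
    proof (intro AE_I2)
      fix x :: real
      obtain N where N: "\<bar>x\<bar> < real N" using reals_Archimedean2 by blast
      show "(\<lambda>n. ennreal (norm (cutoff (real n) f x - f x) powr p)) \<longlonglongrightarrow> 0"
      proof (intro tendsto_eventually eventually_sequentiallyI)
        fix n assume "N \<le> n"
        then have "real N \<le> real n" by simp
        with N have "x \<in> {- real n<..<real n}" by auto
        then show "ennreal (norm (cutoff (real n) f x - f x) powr p) = 0"
          by (simp add: cutoff_def)
      qed
    qed
  qed measurable
  then have seq: "(\<lambda>n. power_integral p (\<lambda>x. cutoff (real n) f x - f x)) \<longlonglongrightarrow> 0"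
    by (simp add: power_integral_def)
  \<comment> \<open>Dominated convergence was applied to a sequence; the error decreases as
    \<open>R\<close> grows, so a single integer with small error controls all larger real
    \<open>R\<close>.\<close>
  show ?thesis
  proof (rule order_tendstoI)
    fix e :: ennreal assume "0 < e"
    with seq have "\<forall>\<^sub>F n in sequentially. power_integral p (\<lambda>x. cutoff (real n) f x - f x) < e"
      by (rule order_tendstoD)
    then obtain n where n: "power_integral p (\<lambda>x. cutoff (real n) f x - f x) < e"
      by (auto simp: eventually_sequentially)
    show "\<forall>\<^sub>F R in at_top. power_integral p (\<lambda>x. cutoff R f x - f x) < e"
    proof (rule eventually_at_top_linorderI[of "real n"])
      fix R assume "real n \<le> R"
      then have "power_integral p (\<lambda>x. cutoff R f x - f x) \<le> power_integral p (\<lambda>x. cutoff (real n) f x - f x)"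
        using p by (intro power_integral_mono_AE) (auto simp: cutoff_def indicator_def)
      with n show "power_integral p (\<lambda>x. cutoff R f x - f x) < e" by simp
    qed
  qed simp
qed

text \<open>Shows that the choice in \<open>fourier\<close> succeeds: the cutoffs are Cauchy in L^p,
  by Hausdorff-Young for their differences the transforms are Cauchy in L^q, and L^q is
  complete.\<close>

lemma fourier_Lp_tendsto:
  assumes p: "1 < p" "p \<le> 2" and q: "q = p / (p - 1)"
    and f[measurable]: "f \<in> borel_measurable borel" and fin: "power_integral p f < \<infinity>"
  shows "Lp_tendsto q (\<lambda>R. fourier_L1 (cutoff R f)) (fourier p f) at_top"
proof -
  have q1: "1 < q" using p by (simp add: q field_simps)
  have int: "integrable lborel (cutoff R f)" for R
    using p by (intro integrable_cutoff[OF f _ fin]) simp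
  let ?L = "at_top \<times>\<^sub>F at_top :: (real \<times> real) filter"
  have lim: "((\<lambda>R. power_integral p (\<lambda>x. cutoff R f x - f x)) \<longlongrightarrow> 0) at_top"
    using p by (intro power_integral_cutoff_tendsto f fin) simp
  have "((\<lambda>z. power_integral p (\<lambda>x. cutoff (fst z) f x - cutoff (snd z) f x)) \<longlongrightarrow> 0) ?L"
  proof (rule power_integral_triangle_tendsto[where G = "\<lambda>_. f"])
    show "((\<lambda>z. power_integral p (\<lambda>x. cutoff (fst z) f x - f x)) \<longlongrightarrow> 0) ?L"
      by (rule filterlim_compose[OF lim filterlim_fst])
    show "((\<lambda>z. power_integral p (\<lambda>x. f x - cutoff (snd z) f x)) \<longlongrightarrow> 0) ?L"
      by (subst power_integral_diff_commute) (rule filterlim_compose[OF lim filterlim_snd])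
  qed (use p in \<open>auto intro!: measurable_completion\<close>)
  then have "((\<lambda>z. power_integral q (fourier_L1 (\<lambda>x. cutoff (fst z) f x - cutoff (snd z) f x))) \<longlongrightarrow> 0) ?L"
    by (intro hausdorff_young_tendsto[OF p q] Bochner_Integration.integrable_diff int)
  then have lim2: "((\<lambda>z. power_integral q (\<lambda>t. fourier_L1 (cutoff (fst z) f) t - fourier_L1 (cutoff (snd z) f) t)) \<longlongrightarrow> 0) ?L"
    by (simp add: fourier_L1_diff[OF int int, abs_def])
  have "\<exists>g. Lp_tendsto q (\<lambda>R. fourier_L1 (cutoff R f)) g at_top"
  proof (rule power_integral_complete)
    fix R
    have "power_integral p (cutoff R f) < \<infinity>"
      using power_integral_cutoff_le[of p R f] p fin by (auto intro: order_le_less_trans)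
    then show "power_integral q (fourier_L1 (cutoff R f)) < \<infinity>"
      by (rule hausdorff_young_finite[OF p q int])
  next
    fix e :: real assume "0 < e"
    then have "\<forall>\<^sub>F z in ?L. power_integral q (\<lambda>t. fourier_L1 (cutoff (fst z) f) t - fourier_L1 (cutoff (snd z) f) t) < ennreal e"
      by (intro order_tendstoD(2)[OF lim2]) simp
    then obtain P Q where PQ: "eventually P at_top" "eventually Q at_top"
      "\<And>R R'. P R \<Longrightarrow> Q R' \<Longrightarrow> power_integral q (\<lambda>t. fourier_L1 (cutoff R f) t - fourier_L1 (cutoff R' f) t) < ennreal e"
      unfolding eventually_prod_filter by auto
    then obtain M N where "\<And>R. M \<le> R \<Longrightarrow> P R" "\<And>R. N \<le> R \<Longrightarrow> Q R"
      unfolding eventually_at_top_linorder by blast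
    then show "\<exists>N. \<forall>R\<ge>N. \<forall>R'\<ge>N. power_integral q (\<lambda>x. fourier_L1 (cutoff R f) x - fourier_L1 (cutoff R' f) x) \<le> ennreal e"
      using PQ(3) by (intro exI[of _ "max M N"]) (auto intro!: less_imp_le)
  qed (use q1 in auto)
  from someI_ex[OF this] show ?thesis
    using p by (simp add: fourier_eq q)
qed

text \<open>The definition approximates by cutoffs of the function itself, but a cutoff of
  \<open>kernel_op k g\<close> is in general not \<open>kernel_op\<close> of cut off data. This
  lemma frees the choice of approximants: two L^p approximations differ by a sequence tending to 0,
  and so do their transforms in L^q.\<close>

lemma fourier_eqI:
  assumes p: "1 < p" "p \<le> 2" and q: "q = p / (p - 1)"
    and f[measurable]: "f \<in> borel_measurable borel" and fin: "power_integral p f < \<infinity>"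
    and F: "\<And>n. integrable lborel (F n)" and h: "h \<in> borel_measurable lebesgue"
    and Ff: "(\<lambda>n. power_integral p (\<lambda>x. F n x - f x)) \<longlonglongrightarrow> 0"
    and Fh: "(\<lambda>n. power_integral q (\<lambda>x. fourier_L1 (F n) x - h x)) \<longlonglongrightarrow> 0"
  shows "AE x in lebesgue. fourier p f x = h x"
proof -
  have q0: "0 < q" using p by (simp add: q)
  have [measurable]: "F n \<in> borel_measurable borel" for n using F[of n] by simp
  let ?c = "\<lambda>n. cutoff (real n) f"
  have int: "integrable lborel (?c n)" for n
    using p by (intro integrable_cutoff[OF f _ fin]) simp
  from fourier_Lp_tendsto[OF p q f fin]
  have g: "fourier p f \<in> borel_measurable lebesgue"
    and lim: "((\<lambda>R. power_integral q (\<lambda>x. fourier_L1 (cutoff R f) x - fourier p f x)) \<longlongrightarrow> 0) at_top"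
    using q0 by (auto simp: Lp_tendsto_iff Lp_space_iff)
  have 1: "(\<lambda>n. power_integral q (\<lambda>x. fourier p f x - fourier_L1 (?c n) x)) \<longlonglongrightarrow> 0"
    by (subst power_integral_diff_commute) (rule filterlim_compose[OF lim filterlim_real_sequentially])
  have "(\<lambda>n. power_integral p (\<lambda>x. ?c n x - F n x)) \<longlonglongrightarrow> 0"
  proof (rule power_integral_triangle_tendsto[where G = "\<lambda>_. f"])
    show "(\<lambda>n. power_integral p (\<lambda>x. ?c n x - f x)) \<longlonglongrightarrow> 0"
      using p by (intro filterlim_compose[OF power_integral_cutoff_tendsto filterlim_real_sequentially] f fin) simp
    show "(\<lambda>n. power_integral p (\<lambda>x. f x - F n x)) \<longlonglongrightarrow> 0"
      by (subst power_integral_diff_commute) (rule Ff)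
  qed (use p in \<open>auto intro!: measurable_completion\<close>)
  then have "(\<lambda>n. power_integral q (fourier_L1 (\<lambda>x. ?c n x - F n x))) \<longlonglongrightarrow> 0"
    by (intro hausdorff_young_tendsto[OF p q] Bochner_Integration.integrable_diff int F)
  then have 2: "(\<lambda>n. power_integral q (\<lambda>x. fourier_L1 (?c n) x - fourier_L1 (F n) x)) \<longlonglongrightarrow> 0"
    by (simp add: fourier_L1_diff[OF int F, abs_def])
  have 3: "(\<lambda>n. power_integral q (\<lambda>x. fourier p f x - fourier_L1 (F n) x)) \<longlonglongrightarrow> 0"
    by (rule power_integral_triangle_tendsto[OF _ _ _ _ 1 2]) (use q0 g in \<open>auto intro!: measurable_completion\<close>)
  have "(\<lambda>n::nat. power_integral q (\<lambda>x. fourier p f x - h x)) \<longlonglongrightarrow> 0"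
    by (rule power_integral_triangle_tendsto[OF _ _ _ _ 3 Fh]) (use q0 g h in \<open>auto intro!: measurable_completion\<close>)
  then have "power_integral q (\<lambda>x. fourier p f x - h x) = 0"
    by (simp add: LIMSEQ_const_iff)
  then have "AE x in lebesgue. fourier p f x - h x = 0"
    using g h by (intro power_integral_eq_0) auto
  then show ?thesis by simp
qed

text \<open>With exponent and parameters free, this serves both sides of the formula:
  \<open>f\<close> in L^p and, for p > 1, its transform in L^q. The third conclusion retains a Borel
  representative for the limit arguments; the point 0 is left out as in
  \<open>stieltjes_cong_AE\<close>.\<close>

lemma Lp_space_stieltjes:
  assumes f: "f \<in> Lp_space p" and p: "1 \<le> p" and b: "0 < b - 1 / p" "b - 1 / p < m"
  shows "stieltjes b m f \<in> Lp_space p"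
    and "AE t in lebesgue. stieltjes_converges b m f t"
    and "\<exists>g. g \<in> borel_measurable borel \<and> (AE x in lebesgue. f x = g x) \<and> power_integral p g < \<infinity> \<and>
      (\<forall>t. t \<noteq> 0 \<longrightarrow> stieltjes b m f t = kernel_op (stieltjes_kernel b m) g t)"
proof -
  have fm: "f \<in> borel_measurable lebesgue" and fin: "power_integral p f < \<infinity>"
    using f by (auto simp: Lp_space_iff)
  obtain g where g[measurable]: "g \<in> borel_measurable borel" and ae: "AE x in lborel. f x = g x"
    using completion_ex_borel_measurable_complex[OF fm] by auto
  then have fg: "AE x in lebesgue. f x = g x" by (simp add: AE_completion_iff)
  have gfin: "power_integral p g < \<infinity>"
    using power_integral_cong_AE[OF ae] fin by metis
  have gl: "g \<in> borel_measurable lebesgue" by (rule measurable_completion) simp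
  note eq = stieltjes_cong_AE[OF fm gl fg, of _ b m]
  note k = kernel_op_power_integral_finite[OF borel_measurable_stieltjes_kernel g stieltjes_kernel_nonneg p
      kernel_moment_stieltjes_finite[OF b] gfin]
  have ne: "AE t in lborel. t \<noteq> (0::real)" by (rule AE_lborel_singleton)
  have *: "stieltjes b m f t = kernel_op (stieltjes_kernel b m) g t" if "t \<noteq> 0" for t
    using eq(1)[OF that] by (simp add: stieltjes_eq_kernel_op)
  have "stieltjes b m f \<in> borel_measurable lebesgue"
  proof (rule measurable_discrete_difference[where X = "{0}"])
    show "kernel_op (stieltjes_kernel b m) g \<in> borel_measurable lebesgue"
      by (rule measurable_completion) simp
  qed (use * in auto)
  moreover have "power_integral p (stieltjes b m f) = power_integral p (kernel_op (stieltjes_kernel b m) g)"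
    using ne by (intro power_integral_cong_AE, eventually_elim) (rule *)
  ultimately show "stieltjes b m f \<in> Lp_space p"
    using k(1) by (simp add: Lp_space_iff)
  have "AE t in lborel. stieltjes_converges b m f t"
    using k(2) ne
  proof eventually_elim
    case (elim t)
    then show ?case using eq(2)[of t] by (simp add: stieltjes_converges_eq_kernel_converges)
  qed
  then show "AE t in lebesgue. stieltjes_converges b m f t"
    by (simp add: AE_completion_iff)
  show "\<exists>g. g \<in> borel_measurable borel \<and> (AE x in lebesgue. f x = g x) \<and> power_integral p g < \<infinity> \<and>
      (\<forall>t. t \<noteq> 0 \<longrightarrow> stieltjes b m f t = kernel_op (stieltjes_kernel b m) g t)"
    using g fg gfin * by blast
qed

section \<open>The transformation formula in L^1 and in L^p\<close>

lemma kernel_op_reciprocal_truncate: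
  "kernel_op (\<lambda>v. truncate_kernel n (stieltjes_kernel b m) (1 / v) / v)
    = kernel_op (truncate_kernel n (stieltjes_kernel (m - b + 1) m))"
  by (rule kernel_op_cong) (rule truncate_kernel_reciprocal)

text \<open>The formula holds at every point, including 0: changing \<open>stieltjes b m f\<close>
  at one point does not affect its Fourier integral, and \<open>f\<close> and its Borel
  representative have literally the same transform.\<close>

lemma fourier_stieltjes_L1:
  assumes f: "f \<in> Lp_space 1" and b: "0 < b - 1" "b - 1 < m"
  shows "fourier_L1 (stieltjes b m f) = stieltjes (m - b + 1) m (fourier_L1 f)"
    and "stieltjes_converges (m - b + 1) m (fourier_L1 f) x"
proof -
  have b': "0 < b - 1 / 1" "b - 1 / 1 < m" using b by auto
  obtain g where g[measurable]: "g \<in> borel_measurable borel" and fg: "AE x in lebesgue. f x = g x"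
    and gfin: "power_integral 1 g < \<infinity>"
    and eq: "\<And>t. t \<noteq> 0 \<Longrightarrow> stieltjes b m f t = kernel_op (stieltjes_kernel b m) g t"
    using Lp_space_stieltjes(3)[OF f _ b'] by auto
  have fm: "f \<in> borel_measurable lebesgue" using f by (simp add: Lp_space_iff)
  have gint: "integrable lborel g"
    using gfin by (simp add: power_integral_def integrable_iff_bounded)
  have gl: "g \<in> borel_measurable lebesgue" by (rule measurable_completion) simp
  have Ff: "fourier_L1 f = fourier_L1 g" by (rule fourier_L1_cong_AE[OF fg fm gl])
  have ne: "AE t in lebesgue. t \<noteq> (0::real)"
    by (simp add: AE_completion_iff AE_lborel_singleton)
  have "fourier_L1 (stieltjes b m f) = fourier_L1 (kernel_op (stieltjes_kernel b m) g)"
  proof (rule fourier_L1_cong_AE)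
    show "AE t in lebesgue. stieltjes b m f t = kernel_op (stieltjes_kernel b m) g t"
      using ne by eventually_elim (rule eq)
    show "stieltjes b m f \<in> borel_measurable lebesgue"
      using Lp_space_stieltjes(1)[OF f _ b'] by (simp add: Lp_space_iff)
    show "kernel_op (stieltjes_kernel b m) g \<in> borel_measurable lebesgue"
      by (rule measurable_completion) simp
  qed
  also have "\<dots> = kernel_op (\<lambda>v. stieltjes_kernel b m (1 / v) / v) (fourier_L1 g)"
    by (intro ext kernel_op_fourier_L1(2) kernel_moment_stieltjes_finite b' gint) auto
  also have "\<dots> = kernel_op (stieltjes_kernel (m - b + 1) m) (fourier_L1 g)"
    by (rule arg_cong[where f = "\<lambda>S. S (fourier_L1 g)"], rule kernel_op_cong)
       (rule stieltjes_kernel_reciprocal)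
  also have "\<dots> = stieltjes (m - b + 1) m (fourier_L1 g)"
    by (rule stieltjes_eq_kernel_op[symmetric]) simp
  finally show "fourier_L1 (stieltjes b m f) = stieltjes (m - b + 1) m (fourier_L1 f)"
    by (simp add: Ff)
  let ?M = "LINT x|lborel. norm (g x)"
  \<comment> \<open>The conjugate exponent is infinite here, beyond the reach of
    \<open>Lp_space_stieltjes\<close>. The transform is bounded instead, so the plain integral of
    the kernel has to be finite; it is the 1-moment of the kernel with first parameter raised by
    one, whence \<open>m - b + 2\<close>.\<close>
  have "kernel_converges (stieltjes_kernel (m - b + 1) m) (fourier_L1 g) x"
    unfolding kernel_converges_def set_integrable_def
  proof (rule integrableI_bounded)
    have "(\<integral>\<^sup>+u. ennreal (norm (indicator {0<..} u *\<^sub>R stieltjes_kernel (m - b + 1) m u *\<^sub>R fourier_L1 g (x * u))) \<partial>lborel)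
        \<le> (\<integral>\<^sup>+u. ennreal ?M * (ennreal (stieltjes_kernel (m - b + 2) m u * u powr (- 1 / 1)) * indicator {0<..} u) \<partial>lborel)"
    proof (intro nn_integral_mono)
      fix u :: real
      show "ennreal (norm (indicator {0<..} u *\<^sub>R stieltjes_kernel (m - b + 1) m u *\<^sub>R fourier_L1 g (x * u)))
          \<le> ennreal ?M * (ennreal (stieltjes_kernel (m - b + 2) m u * u powr (- 1 / 1)) * indicator {0<..} u)"
      proof (cases "0 < u")
        case True
        have "u powr (m - b + 2 - 1) * u powr (- 1 / 1) = u powr (m - b + 1 - 1)"
          by (simp only: powr_add[symmetric]) simp
        then have "stieltjes_kernel (m - b + 2) m u * u powr (- 1 / 1) = stieltjes_kernel (m - b + 1) m u"
          by (simp only: stieltjes_kernel_def times_divide_eq_left)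
        moreover have "stieltjes_kernel (m - b + 1) m u * norm (fourier_L1 g (x * u)) \<le> ?M * stieltjes_kernel (m - b + 1) m u"
          by (subst mult.commute) (intro mult_right_mono norm_fourier_L1_le gint stieltjes_kernel_nonneg)
        ultimately show ?thesis
          using True by (simp add: ennreal_leI flip: ennreal_mult)
      qed simp
    qed
    also have "\<dots> = ennreal ?M * kernel_moment 1 (stieltjes_kernel (m - b + 2) m)"
      unfolding kernel_moment_def by (rule nn_integral_cmult) measurable
    also have "\<dots> < \<infinity>"
      using kernel_moment_stieltjes_finite[of "m - b + 2" 1 m] b by (simp add: ennreal_mult_less_top)
    finally show "(\<integral>\<^sup>+u. ennreal (norm (indicator {0<..} u *\<^sub>R stieltjes_kernel (m - b + 1) m u *\<^sub>R fourier_L1 g (x * u))) \<partial>lborel) < \<infinity>" .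
  qed measurable
  then show "stieltjes_converges (m - b + 1) m (fourier_L1 f) x"
    by (simp add: Ff stieltjes_converges_eq_kernel_converges)
qed

lemma fourier_stieltjes_Lp:
  assumes p: "1 < p" "p \<le> 2" and f: "f \<in> Lp_space p" and b: "0 < b - 1 / p" "b - 1 / p < m"
  shows "AE x in lebesgue. fourier p (stieltjes b m f) x = stieltjes (m - b + 1) m (fourier p f) x"
    and "AE x in lebesgue. stieltjes_converges (m - b + 1) m (fourier p f) x"
proof -
  define q where "q = p / (p - 1)"
  have q1: "1 < q" using p by (simp add: q_def field_simps)
  have "1 / q = 1 - 1 / p" using p by (simp add: q_def field_simps)
  \<comment> \<open>Conjugacy gives \<open>(m - b + 1) - 1 / q = m - (b - 1 / p)\<close>: the
    conditions at 0 and at infinity change places.\<close>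
  then have b': "0 < (m - b + 1) - 1 / q" "(m - b + 1) - 1 / q < m"
    using b by auto
  have p1: "1 \<le> p" using p by simp
  let ?k = "stieltjes_kernel b m" and ?l = "stieltjes_kernel (m - b + 1) m"
  obtain g where g[measurable]: "g \<in> borel_measurable borel" and fg: "AE x in lebesgue. f x = g x"
    and gfin: "power_integral p g < \<infinity>"
    and eq: "\<And>t. t \<noteq> 0 \<Longrightarrow> stieltjes b m f t = kernel_op ?k g t"
    using Lp_space_stieltjes(3)[OF f p1 b] by auto
  have fm: "f \<in> borel_measurable lebesgue" using f by (simp add: Lp_space_iff)
  have gl: "g \<in> borel_measurable lebesgue" by (rule measurable_completion) simp
  have Ff: "fourier p f = fourier p g" by (rule fourier_cong_AE[OF fg fm gl])
  have ne: "AE t in lebesgue. t \<noteq> (0::real)"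
    by (simp add: AE_completion_iff AE_lborel_singleton)
  have Ss: "fourier p (stieltjes b m f) = fourier p (kernel_op ?k g)"
  proof (rule fourier_cong_AE)
    show "AE t in lebesgue. stieltjes b m f t = kernel_op ?k g t"
      using ne by eventually_elim (rule eq)
    show "stieltjes b m f \<in> borel_measurable lebesgue"
      using Lp_space_stieltjes(1)[OF f p1 b] by (simp add: Lp_space_iff)
    show "kernel_op ?k g \<in> borel_measurable lebesgue"
      by (rule measurable_completion) simp
  qed
  let ?c = "\<lambda>n. cutoff (real n) g"
  have cint: "integrable lborel (?c n)" for n
    by (rule integrable_cutoff[OF g p1 gfin])
  have lim: "Lp_tendsto q (\<lambda>R. fourier_L1 (cutoff R g)) (fourier p g) at_top"
    by (rule fourier_Lp_tendsto[OF p q_def g gfin])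
  then have G: "fourier p g \<in> Lp_space q" by (simp add: Lp_tendsto_def)
  show "AE x in lebesgue. stieltjes_converges (m - b + 1) m (fourier p f) x"
    unfolding Ff using q1 by (intro Lp_space_stieltjes(2)[OF G _ b']) simp
  obtain h where h[measurable]: "h \<in> borel_measurable borel" and Gh: "AE x in lebesgue. fourier p g x = h x"
    and hfin: "power_integral q h < \<infinity>"
    and eqh: "\<And>t. t \<noteq> 0 \<Longrightarrow> stieltjes (m - b + 1) m (fourier p g) t = kernel_op ?l h t"
    using Lp_space_stieltjes(3)[OF G _ b'] q1 by auto
  have cfin: "power_integral p (?c n) < \<infinity>" for n
    using power_integral_cutoff_le[of p "real n" g] gfin p1 by (auto intro: order_le_less_trans)
  have k1: "(\<lambda>n. power_integral p (\<lambda>x. kernel_op (truncate_kernel n ?k) (?c n) x - kernel_op ?k g x)) \<longlonglongrightarrow> 0"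
    using p by (intro kernel_op_truncate_tendsto kernel_moment_stieltjes_finite b gfin cfin
        filterlim_compose[OF power_integral_cutoff_tendsto filterlim_real_sequentially]) auto
  have Fc: "(\<lambda>n. power_integral q (\<lambda>x. fourier_L1 (?c n) x - h x)) \<longlonglongrightarrow> 0"
  proof -
    have "(\<lambda>n. power_integral q (\<lambda>x. fourier_L1 (?c n) x - fourier p g x)) \<longlonglongrightarrow> 0"
      using lim q1 by (intro filterlim_compose[OF _ filterlim_real_sequentially,
          of "\<lambda>R. power_integral q (\<lambda>x. fourier_L1 (cutoff R g) x - fourier p g x)"]) (simp add: Lp_tendsto_iff)
    moreover have "power_integral q (\<lambda>x. fourier_L1 (?c n) x - fourier p g x)
        = power_integral q (\<lambda>x. fourier_L1 (?c n) x - h x)" for n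
      using Gh by (intro power_integral_cong_AE) (auto simp: AE_completion_iff elim!: eventually_mono)
    ultimately show ?thesis by simp
  qed
  have Fcfin: "power_integral q (fourier_L1 (?c n)) < \<infinity>" for n
    by (rule hausdorff_young_finite[OF p q_def cint cfin])
  have l1: "(\<lambda>n. power_integral q (\<lambda>x. kernel_op (truncate_kernel n ?l) (fourier_L1 (?c n)) x - kernel_op ?l h x)) \<longlonglongrightarrow> 0"
    using q1 by (intro kernel_op_truncate_tendsto kernel_moment_stieltjes_finite b' hfin Fcfin Fc) auto
  have t0: "0 \<le> truncate_kernel n ?k u" for n u by (simp add: truncate_kernel_def)
  have t1: "kernel_moment 1 (truncate_kernel n ?k) < \<infinity>" for n
    by (intro kernel_moment_truncate_finite[OF _ _ p1] kernel_moment_stieltjes_finite b) auto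
  note trunc = kernel_op_fourier_L1[OF borel_measurable_truncate_kernel[OF borel_measurable_stieltjes_kernel] t0 t1 cint]
  \<comment> \<open>The approximants are the truncated operators applied to the cutoffs:
    \<open>trunc\<close> gives the exact formula for them, \<open>k1\<close> their limit in L^p, and
    \<open>l1\<close> the limit of their transforms in L^q.\<close>
  have "AE x in lebesgue. fourier p (kernel_op ?k g) x = kernel_op ?l h x"
  proof (rule fourier_eqI[OF p q_def])
    show "power_integral p (kernel_op ?k g) < \<infinity>"
      by (intro kernel_op_power_integral_finite kernel_moment_stieltjes_finite b gfin p1) auto
    show "integrable lborel (kernel_op (truncate_kernel n ?k) (?c n))" for n
      by (rule trunc(1))
    have "fourier_L1 (kernel_op (truncate_kernel n ?k) (?c n)) = kernel_op (truncate_kernel n ?l) (fourier_L1 (?c n))" for n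
      by (rule ext) (simp only: trunc(2) kernel_op_reciprocal_truncate)
    with l1 show "(\<lambda>n. power_integral q (\<lambda>x. fourier_L1 (kernel_op (truncate_kernel n ?k) (?c n)) x - kernel_op ?l h x)) \<longlonglongrightarrow> 0"
      by simp
    show "(\<lambda>n. power_integral p (\<lambda>x. kernel_op (truncate_kernel n ?k) (?c n) x - kernel_op ?k g x)) \<longlonglongrightarrow> 0"
      by (rule k1)
    show "kernel_op ?l h \<in> borel_measurable lebesgue"
      by (rule measurable_completion) simp
  qed simp
  then show "AE x in lebesgue. fourier p (stieltjes b m f) x = stieltjes (m - b + 1) m (fourier p f) x"
    unfolding Ss Ff using ne by eventually_elim (simp add: eqh)
qed

theorem theorem5:
  fixes p \<beta> \<mu> :: real
  assumes "1 \<le> p" and "p \<le> 2"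
    and "0 < \<beta> - 1 / p" and "\<beta> - 1 / p < \<mu>"
  shows "(\<forall>f\<in>Lp_space p.
            stieltjes \<beta> \<mu> f \<in> Lp_space p \<and>
            (AE t in lebesgue. stieltjes_converges \<beta> \<mu> f t) \<and>
            (AE x in lebesgue. stieltjes_converges (\<mu> - \<beta> + 1) \<mu> (fourier p f) x) \<and>
            (p = 1 \<longrightarrow> fourier p (stieltjes \<beta> \<mu> f) = stieltjes (\<mu> - \<beta> + 1) \<mu> (fourier p f)) \<and>
            (AE x in lebesgue.
               fourier p (stieltjes \<beta> \<mu> f) x = stieltjes (\<mu> - \<beta> + 1) \<mu> (fourier p f) x)) \<and>
         (\<forall>n::nat. \<forall>f\<in>T_space n p.
            (p = 1 \<longrightarrow> fourier p (stieltjes \<beta> \<mu> f) = stieltjes (\<mu> - \<beta> + 1) \<mu> (fourier p f)) \<and>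
            (AE x in lebesgue.
               fourier p (stieltjes \<beta> \<mu> f) x = stieltjes (\<mu> - \<beta> + 1) \<mu> (fourier p f) x))"
proof -
  have main: "stieltjes \<beta> \<mu> f \<in> Lp_space p \<and>
      (AE t in lebesgue. stieltjes_converges \<beta> \<mu> f t) \<and>
      (AE x in lebesgue. stieltjes_converges (\<mu> - \<beta> + 1) \<mu> (fourier p f) x) \<and>
      (p = 1 \<longrightarrow> fourier p (stieltjes \<beta> \<mu> f) = stieltjes (\<mu> - \<beta> + 1) \<mu> (fourier p f)) \<and>
      (AE x in lebesgue.
         fourier p (stieltjes \<beta> \<mu> f) x = stieltjes (\<mu> - \<beta> + 1) \<mu> (fourier p f) x)"
    if f: "f \<in> Lp_space p" for f
  proof (cases "p = 1")
    case True
    then show ?thesis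
      using Lp_space_stieltjes(1,2)[OF f assms(1,3,4)] fourier_stieltjes_L1[of f \<beta> \<mu>] f assms
      by (simp add: fourier_def)
  next
    case False
    then show ?thesis
      using Lp_space_stieltjes(1,2)[OF f assms(1,3,4)] fourier_stieltjes_Lp[OF _ assms(2) f assms(3,4)] assms(1)
      by simp
  qed
  moreover have "T_space n p \<subseteq> Lp_space p" for n
    by (auto simp: T_space_def Lp_tendsto_def)
  ultimately show ?thesis by blast
qed

end
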